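(* Let $\lambda,\mu$ be partitions with $\mu\subseteq\lambda$ and let $r\ge 0$ be an integer. Then $$s_{\lambda/\mu}\cdot\widetilde p_r=\sum_{\lambda^+,\mu^-}(-1)^{|\mu/\mu^-|}\,(-q)^{\mathrm{ht}(\lambda^+/\lambda)+\mathrm{wt}(\mu/\mu^-)}\,(1-q)^{\mathrm{rib}(\lambda^+/\lambda)+\mathrm{rib}(\mu/\mu^-)-1}\,s_{\lambda^+/\mu^-},$$ where the sum is over all pairs of partitions $\lambda^+\supseteq\lambda$, $\mu^-\subseteq\mu$ such that $\lambda^+/\lambda$ and $\mu/\mu^-$ are broken ribbons with $|\lambda^+/\lambda|+|\mu/\mu^-|=r$.
   Context: For partitions, $\mu\subseteq\lambda$ means $\mu_i\le\lambda_i$ for all $i$ (with $\lambda_i=0$ for $i>\ell(\lambda)$, where $\ell(\lambda)$ is the number of parts). The skew diagram is $[\lambda/\mu]=\{(i,j):1\le i\le\ell(\lambda),\ \mu_i<j\le\lambda_i\}$ (row $i$, column $j$, rows numbered from top to bottom), and its size is $|\lambda/\mu|=|\lambda|-|\mu|$. A skew shape $\lambda/\mu$ is a ribbon if $[\lambda/\mu]$ is (non-empty and) connected and contains no $2\times 2$ block. It is a broken ribbon if $[\lambda/\mu]$ contains no $2\times2$ block (the empty shape is allowed); its diagram is then a disjoint union of $\mathrm{rib}(\lambda/\mu)$ ribbons (its connected components). The height $\mathrm{ht}$ (resp. width $\mathrm{wt}$) of a ribbon is the number of its non-empty rows (resp. columns) minus $1$; the height (resp. width) of a broken ribbon is the sum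 of the heights (resp. widths) of its component ribbons. The empty shape has height, width and $\mathrm{rib}$ all equal to $0$. $s_{\lambda/\mu}$ is the skew Schur function in $x_1,x_2,\dots$, $m_\tau$ is the monomial symmetric function, and $q$ is an indeterminate. The quantum power sum function is $$\widetilde p_r=\sum_{\tau\vdash r}(-1)^{\ell(\tau)-1}(q-1)^{\ell(\tau)-1}m_\tau .$$ For $r=0$ this formula is read literally (with $\tau=\emptyset$, $\ell(\tau)=0$, $m_\emptyset=1$). *)

theory Defs
  imports
    "HOL-Library.FuncSet"
    "HOL-Library.Poly_Mapping"
    "HOL-Library.Multiset"
    "HOL-Computational_Algebra.Polynomial"
    "HOL-Computational_Algebra.Fraction_Field"
begin

section \<open>Formal power series in countably many variables\<close>

text \<open>
  A monomial is an exponent vector of type \<open>nat \<Rightarrow>\<^sub>0 nat\<close>, where the index \<open>n\<close> stands for the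
  variable $x_{n+1}$.  A power series is an arbitrary family of coefficients indexed by monomials.
\<close>

type_synonym monomial = "nat \<Rightarrow>\<^sub>0 nat"

abbreviation expo :: "monomial \<Rightarrow> nat \<Rightarrow> nat" where
  "expo \<equiv> Poly_Mapping.lookup"

abbreviation vars :: "monomial \<Rightarrow> nat set" where
  "vars \<equiv> Poly_Mapping.keys"

typedef 'a mseries = "UNIV :: (monomial \<Rightarrow> 'a) set"
  morphisms mcoeff MSeries ..

lemma mcoeff_MSeries [simp]: "mcoeff (MSeries f) m = f m"
  by (simp add: MSeries_inverse)

lemma mseries_eqI: "(\<And>m. mcoeff f m = mcoeff g m) \<Longrightarrow> f = g"
  by (metis ext mcoeff_inject)

definition splittings :: "monomial \<Rightarrow> (monomial \<times> monomial) set" where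
  "splittings m = {(a, b). a + b = m}"

lemma finite_monomials_below: "finite {a :: monomial. \<exists>b. a + b = m}"
proof -
  let ?F = "{f. \<forall>x. (x \<in> vars m \<longrightarrow> f x \<in> {..Max (insert 0 (expo m ` vars m))}) \<and>
                    (x \<notin> vars m \<longrightarrow> f x = (0::nat))}"
  have "expo ` {a. \<exists>b. a + b = m} \<subseteq> ?F"
  proof (clarify, intro conjI impI)
    fix a b x assume m: "m = a + b"
    have le: "expo a x \<le> expo (a + b) x" by (simp add: lookup_add)
    show "expo a x \<in> {..Max (insert 0 (expo (a + b) ` vars (a + b)))}"
      if "x \<in> vars (a + b)"
    proof -
      have "expo (a + b) x \<le> Max (insert 0 (expo (a + b) ` vars (a + b)))"
        using that by (intro Max_ge) auto
      with le show ?thesis by (simp only: atMost_iff)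
    qed
    show "expo a x = 0" if "x \<notin> vars (a + b)"
      using that le by (simp add: in_keys_iff)
  qed
  moreover have "finite ?F" by (rule finite_set_of_finite_funs) auto
  ultimately have "finite (expo ` {a. \<exists>b. a + b = m})" by (rule finite_subset)
  then show ?thesis by (rule finite_imageD) (simp add: inj_on_def)
qed

lemma finite_splittings [simp]: "finite (splittings m)"
proof -
  have "splittings m \<subseteq> {a. \<exists>b. a + b = m} \<times> {a. \<exists>b. a + b = m}"
    by (auto simp: splittings_def) (metis add.commute)
  then show ?thesis
    by (rule finite_subset) (simp add: finite_monomials_below)
qed

instantiation mseries :: (comm_ring_1) comm_ring_1
begin

definition "0 = MSeries (\<lambda>_. 0)"
definition "1 = MSeries (\<lambda>m. if m = 0 then 1 else 0)"
definition "f + g = MSeries (\<lambda>m. mcoeff f m + mcoeff g m)"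
definition "f - g = MSeries (\<lambda>m. mcoeff f m - mcoeff g m)"
definition "- f = MSeries (\<lambda>m. - mcoeff f m)"
definition "f * g = MSeries (\<lambda>m. \<Sum>(a, b)\<in>splittings m. mcoeff f a * mcoeff g b)"

lemmas mseries_ops_defs =
  zero_mseries_def one_mseries_def plus_mseries_def minus_mseries_def uminus_mseries_def
  times_mseries_def

instance
proof
  fix f g h :: "'a mseries"
  show "f * g * h = f * (g * h)"
  proof (rule mseries_eqI)
    fix m
    have "mcoeff (f * g * h) m =
        (\<Sum>(u, c)\<in>splittings m. \<Sum>(a, b)\<in>splittings u. mcoeff f a * mcoeff g b * mcoeff h c)"
      by (simp add: times_mseries_def sum_distrib_right case_prod_unfold)
    also have "\<dots> = (\<Sum>(p, q)\<in>(SIGMA p:splittings m. splittings (fst p)).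
                       mcoeff f (fst q) * mcoeff g (snd q) * mcoeff h (snd p))"
      by (subst sum.Sigma [symmetric]) (auto simp: case_prod_unfold)
    also have "\<dots> = (\<Sum>(p, q)\<in>(SIGMA p:splittings m. splittings (snd p)).
                       mcoeff f (fst p) * (mcoeff g (fst q) * mcoeff h (snd q)))"
      by (rule sum.reindex_bij_witness
          [where i = "\<lambda>(p, q). ((fst p + fst q, snd q), (fst p, fst q))"
             and j = "\<lambda>(p, q). ((fst q, snd q + snd p), (snd q, snd p))"])
        (auto simp: splittings_def ac_simps)
    also have "\<dots> =
        (\<Sum>(a, u)\<in>splittings m. \<Sum>(b, c)\<in>splittings u. mcoeff f a * (mcoeff g b * mcoeff h c))"
      by (subst sum.Sigma [symmetric]) (auto simp: case_prod_unfold)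
    also have "\<dots> = mcoeff (f * (g * h)) m"
      by (simp add: times_mseries_def sum_distrib_left case_prod_unfold)
    finally show "mcoeff (f * g * h) m = mcoeff (f * (g * h)) m" .
  qed
  show "f * g = g * f"
  proof (rule mseries_eqI)
    fix m
    show "mcoeff (f * g) m = mcoeff (g * f) m"
      unfolding times_mseries_def mcoeff_MSeries
      by (rule sum.reindex_bij_witness [where i = "\<lambda>(a, b). (b, a)" and j = "\<lambda>(a, b). (b, a)"])
        (auto simp: splittings_def ac_simps)
  qed
  show "1 * f = f"
  proof (rule mseries_eqI)
    fix m
    have "mcoeff (1 * f) m =
        (\<Sum>p\<in>splittings m. if p = (0, m) then mcoeff f m else 0)"
      unfolding times_mseries_def one_mseries_def mcoeff_MSeries
      by (rule sum.cong) (auto simp: splittings_def split: if_splits)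
    also have "\<dots> = mcoeff f m"
      by (subst sum.delta [OF finite_splittings]) (simp add: splittings_def)
    finally show "mcoeff (1 * f) m = mcoeff f m" .
  qed
  show "(f + g) * h = f * h + g * h"
    by (simp add: times_mseries_def plus_mseries_def distrib_right sum.distrib case_prod_unfold)
  show "(0 :: 'a mseries) \<noteq> 1"
  proof
    assume "(0 :: 'a mseries) = 1"
    then have "mcoeff (0 :: 'a mseries) 0 = mcoeff 1 0" by simp
    then show False by (simp add: zero_mseries_def one_mseries_def)
  qed
qed (auto intro!: mseries_eqI
      simp: zero_mseries_def plus_mseries_def minus_mseries_def uminus_mseries_def algebra_simps)

end

definition mscale :: "'a::comm_ring_1 \<Rightarrow> 'a mseries \<Rightarrow> 'a mseries" (infixr "*\<^sub>m" 75) where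
  "c *\<^sub>m f = MSeries (\<lambda>m. c * mcoeff f m)"

section \<open>Partitions and skew diagrams\<close>

text \<open>Partitions are lists of their parts; \<open>length\<close> is the number of parts, \<open>sum_list\<close> the size.\<close>

definition is_partition :: "nat list \<Rightarrow> bool" where
  "is_partition la \<longleftrightarrow> sorted_wrt (\<ge>) la \<and> 0 \<notin> set la"

text \<open>Parts are numbered from \<open>1\<close>; the junk value at index \<open>0\<close> is never used.\<close>

definition part :: "nat list \<Rightarrow> nat \<Rightarrow> nat" where
  "part la i = (if 1 \<le> i \<and> i \<le> length la then la ! (i - 1) else 0)"

definition contained :: "nat list \<Rightarrow> nat list \<Rightarrow> bool" (infix "\<subseteq>\<^sub>p" 50) where
  "mu \<subseteq>\<^sub>p la \<longleftrightarrow> (\<forall>i\<ge>1. part mu i \<le> part la i)"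

type_synonym cell = "nat \<times> nat"

definition skew_diagram :: "nat list \<Rightarrow> nat list \<Rightarrow> cell set" where
  "skew_diagram la mu = {(i, j). 1 \<le> i \<and> i \<le> length la \<and> part mu i < j \<and> j \<le> part la i}"

text \<open>Truncated subtraction is harmless, since only shapes with \<open>mu \<subseteq>\<^sub>p la\<close> are considered.\<close>

definition skew_size :: "nat list \<Rightarrow> nat list \<Rightarrow> nat" where
  "skew_size la mu = sum_list la - sum_list mu"

section \<open>Broken ribbons\<close>

definition has_square :: "cell set \<Rightarrow> bool" where
  "has_square D \<longleftrightarrow> (\<exists>i j. {(i, j), (i, j + 1), (i + 1, j), (i + 1, j + 1)} \<subseteq> D)"

definition broken_ribbon :: "nat list \<Rightarrow> nat list \<Rightarrow> bool" where
  "broken_ribbon la mu \<longleftrightarrow> \<not> has_square (skew_diagram la mu)"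

text \<open>Two cells are adjacent if they share an edge; touching in a corner is not enough.\<close>

definition adjacent :: "cell rel" where
  "adjacent = {((i, j), (i', j')).
     (i = i' \<and> (j' = j + 1 \<or> j = j' + 1)) \<or> (j = j' \<and> (i' = i + 1 \<or> i = i' + 1))}"

definition components :: "cell set \<Rightarrow> cell set set" where
  "components D = D // Restr ((Restr adjacent D)\<^sup>*) D"

definition rib :: "nat list \<Rightarrow> nat list \<Rightarrow> nat" where
  "rib la mu = card (components (skew_diagram la mu))"

definition ht :: "nat list \<Rightarrow> nat list \<Rightarrow> nat" where
  "ht la mu = (\<Sum>C\<in>components (skew_diagram la mu). card (fst ` C) - 1)"

definition wt :: "nat list \<Rightarrow> nat list \<Rightarrow> nat" where
  "wt la mu = (\<Sum>C\<in>components (skew_diagram la mu). card (snd ` C) - 1)"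

section \<open>Symmetric functions\<close>

text \<open>
  An entry \<open>n\<close> of a tableau stands for the positive integer \<open>n + 1\<close>, in accordance with the
  numbering of the variables.  Tableaux are extensional so that they can be counted.
\<close>

definition ssyt :: "nat list \<Rightarrow> nat list \<Rightarrow> (cell \<Rightarrow> nat) set" where
  "ssyt la mu = {T \<in> extensional (skew_diagram la mu).
     (\<forall>i j j'. (i, j) \<in> skew_diagram la mu \<longrightarrow> (i, j') \<in> skew_diagram la mu \<longrightarrow> j < j' \<longrightarrow>
        T (i, j) \<le> T (i, j')) \<and>
     (\<forall>i i' j. (i, j) \<in> skew_diagram la mu \<longrightarrow> (i', j) \<in> skew_diagram la mu \<longrightarrow> i < i' \<longrightarrow>
        T (i, j) < T (i', j))}"

definition content :: "nat list \<Rightarrow> nat list \<Rightarrow> (cell \<Rightarrow> nat) \<Rightarrow> monomial" where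
  "content la mu T = (\<Sum>c\<in>skew_diagram la mu. Poly_Mapping.single (T c) 1)"

definition skew_schur :: "nat list \<Rightarrow> nat list \<Rightarrow> 'a::comm_ring_1 mseries" where
  "skew_schur la mu = MSeries (\<lambda>m. of_nat (card {T \<in> ssyt la mu. content la mu T = m}))"

text \<open>
  \<open>monomial_sym tau\<close> is the sum of all distinct monomials whose multiset of non-zero exponents
  is the multiset of parts of \<open>tau\<close>.
\<close>

definition monomial_sym :: "nat list \<Rightarrow> 'a::comm_ring_1 mseries" where
  "monomial_sym tau =
     MSeries (\<lambda>m. if image_mset (expo m) (mset_set (vars m)) = mset tau then 1 else 0)"

text \<open>
  The exponent is an integer: for \<open>r = 0\<close> it is \<open>-1\<close>.
\<close>

definition quantum_power_sum :: "'a::field \<Rightarrow> nat \<Rightarrow> 'a mseries" where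
  "quantum_power_sum q r = (\<Sum>tau | is_partition tau \<and> sum_list tau = r.
     ((-1) powi (int (length tau) - 1) * (q - 1) powi (int (length tau) - 1)) *\<^sub>m monomial_sym tau)"

definition q_indet :: "rat poly fract" where
  "q_indet = Fract [:0, 1:] 1"

section \<open>Finiteness\<close>

lemma finite_partitions_le: "finite {la. is_partition la \<and> sum_list la \<le> n}"
proof (rule finite_subset)
  show "finite {la. set la \<subseteq> {..n} \<and> length la \<le> n}"
    by (rule finite_lists_length_le) simp
  have len: "length la \<le> sum_list la" if "0 \<notin> set la" for la :: "nat list"
    using that by (induction la) auto
  show "{la. is_partition la \<and> sum_list la \<le> n} \<subseteq> {la. set la \<subseteq> {..n} \<and> length la \<le> n}"
  proof (clarify, intro conjI subsetI)
    fix la assume la: "is_partition la" "sum_list la \<le> n"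
    show "x \<in> {..n}" if "x \<in> set la" for x
      using member_le_sum_list [OF that] la(2) by simp
    show "length la \<le> n"
      using len [of la] la by (simp add: is_partition_def)
  qed
qed

lemma finite_partitions: "finite {la. is_partition la \<and> sum_list la = r}"
  by (rule finite_subset [OF _ finite_partitions_le [of r]]) auto

lemma finite_contained: "finite {nu. is_partition nu \<and> nu \<subseteq>\<^sub>p mu}"
proof (rule finite_subset)
  show "finite {nu. set nu \<subseteq> {..sum_list mu} \<and> length nu \<le> length mu}"
    by (rule finite_lists_length_le) simp
  show "{nu. is_partition nu \<and> nu \<subseteq>\<^sub>p mu} \<subseteq>
        {nu. set nu \<subseteq> {..sum_list mu} \<and> length nu \<le> length mu}"
  proof (clarify, intro conjI subsetI)
    fix nu assume nu: "is_partition nu" "nu \<subseteq>\<^sub>p mu"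
    have part_le: "part mu i \<le> sum_list mu" for i
      by (auto simp: part_def intro!: member_le_sum_list nth_mem)
    show "x \<in> {..sum_list mu}" if "x \<in> set nu" for x
    proof -
      from that obtain k where k: "k < length nu" "x = nu ! k" by (auto simp: in_set_conv_nth)
      then have "x = part nu (Suc k)" by (simp add: part_def)
      also have "\<dots> \<le> part mu (Suc k)" using nu(2) by (simp add: contained_def)
      also have "\<dots> \<le> sum_list mu" by (rule part_le)
      finally show ?thesis by simp
    qed
    show "length nu \<le> length mu"
    proof (rule ccontr)
      assume less: "\<not> length nu \<le> length mu"
      then have "nu ! (length nu - 1) \<in> set nu" by (intro nth_mem) linarith
      then have "nu ! (length nu - 1) \<noteq> 0"
        using nu(1) by (metis is_partition_def)
      then have "part nu (length nu) > 0"
        using less by (auto simp: part_def Suc_le_eq)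
      moreover have "1 \<le> length nu" using less by linarith
      then have "part nu (length nu) \<le> part mu (length nu)"
        using nu(2) unfolding contained_def by blast
      ultimately show False using less by (simp add: part_def)
    qed
  qed
qed

lemma finite_skew_diagram: "finite (skew_diagram la mu)"
proof (rule finite_subset)
  show "skew_diagram la mu \<subseteq> Sigma {..length la} (\<lambda>i. {..part la i})"
    by (auto simp: skew_diagram_def)
qed simp

lemma finite_ssyt_content: "finite {T \<in> ssyt la mu. content la mu T = m}"
proof (rule finite_subset)
  show "{T \<in> ssyt la mu. content la mu T = m} \<subseteq> skew_diagram la mu \<rightarrow>\<^sub>E vars m"
  proof (clarify, rule PiE_I)
    fix T c assume T: "T \<in> ssyt la mu" and c: "c \<in> skew_diagram la mu"
    have "expo (content la mu T) (T c) \<ge> expo (Poly_Mapping.single (T c) (1::nat)) (T c)"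
      unfolding content_def lookup_sum
      by (rule member_le_sum [OF c]) (simp_all add: finite_skew_diagram)
    then show "T c \<in> vars (content la mu T)" by (simp add: in_keys_iff)
  next
    fix T c assume "T \<in> ssyt la mu" "c \<notin> skew_diagram la mu"
    then show "T c = undefined"
      unfolding ssyt_def by (blast intro: extensional_arb)
  qed
qed (simp add: finite_PiE finite_skew_diagram)

text \<open>The pairs $(\lambda^+, \mu^-)$ indexing the right-hand side.\<close>

definition ribbon_pairs :: "nat list \<Rightarrow> nat list \<Rightarrow> nat \<Rightarrow> (nat list \<times> nat list) set" where
  "ribbon_pairs la mu r = {(lp, mm).
     is_partition lp \<and> is_partition mm \<and> la \<subseteq>\<^sub>p lp \<and> mm \<subseteq>\<^sub>p mu \<and>
     broken_ribbon lp la \<and> broken_ribbon mu mm \<and> skew_size lp la + skew_size mu mm = r}"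

lemma finite_ribbon_pairs: "finite (ribbon_pairs la mu r)"
proof (rule finite_subset)
  show "ribbon_pairs la mu r \<subseteq>
      {lp. is_partition lp \<and> sum_list lp \<le> sum_list la + r} \<times> {nu. is_partition nu \<and> nu \<subseteq>\<^sub>p mu}"
    by (auto simp: ribbon_pairs_def skew_size_def)
qed (intro finite_cartesian_product finite_partitions_le finite_contained)

end

theory Submission
  imports Defs
begin

text \<open>
  Regard a function of two partitions as a matrix over a commutative ring.  Let \<open>U\<^sub>t\<close> have the
  entry \<open>t\<close> to the power \<open>|ga/la|\<close> at \<open>(ga, la)\<close> if \<open>ga/la\<close> is a horizontal strip, and \<open>0\<close>
  otherwise (\<open>strip_weight\<close>).  Peeling off the cells with the largest entry of a tableau removes a
  horizontal strip, so the matrix \<open>S\<close> of the skew Schur functions is a product of matrices \<open>U\<close>, one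
  for each variable (\<open>tableau_count_top_variable\<close>).

  Broken ribbons enter through the matrix \<open>R\<^sub>s\<^sub>,\<^sub>t\<close> (\<open>ribbon_weight\<close>), the quotient of
  \<open>U\<^sub>s\<close> by \<open>U\<^sub>t\<close>, that is \<open>R\<^sub>s\<^sub>,\<^sub>t U\<^sub>t = U\<^sub>s\<close> (\<open>ribbon_weight_times_strip_weight\<close>).  Its entry is supported on broken ribbons,
  where it equals \<open>(-t)^ht * (s - t)^rib * s^wt\<close> (\<open>ribbon_weight_eq\<close>).  Both statements become
  visible when the entries are written as products over the rows of the diagram: the sum over the
  intermediate partition then splits into independent sums over the length of each row, and these
  are geometric sums.

  Two facts about \<open>R\<close> remain.  First, \<open>R\<^sub>t\<^sub>,\<^sub>s R\<^sub>s\<^sub>,\<^sub>t\<close> is the identity (\<open>ribbon_weight_inverse\<close>).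
  Secondly, let \<open>U(x)\<close> be the matrix \<open>U\<^sub>x\<close> belonging to a variable \<open>x\<close> and \<open>^T\<close> the transpose.
  A reflection of row lengths gives \<open>U\<^sub>t^T U(x) = 1 / (1 - t * x) * U(x) U\<^sub>t^T\<close> (\<open>strips_commute\<close>),
  and hence \<open>R\<^sub>s\<^sub>,\<^sub>t^T U(x) = (1 - t * x) / (1 - s * x) * U(x) R\<^sub>s\<^sub>,\<^sub>t^T\<close> (\<open>ribbon_weight_commute\<close>).
  Moving \<open>R\<^sub>s\<^sub>,\<^sub>t^T\<close> through all factors of \<open>S\<close> and cancelling it against \<open>R\<^sub>t\<^sub>,\<^sub>s^T\<close> shows that
  \<open>R\<^sub>s\<^sub>,\<^sub>t^T S R\<^sub>t\<^sub>,\<^sub>s^T\<close> is \<open>S\<close> times the product of \<open>(1 - t * x) / (1 - s * x)\<close> over all variables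
  (\<open>tableau_count_times_monomial_weight\<close>).

  For \<open>s = 1\<close> and \<open>t = q\<close> the coefficient of that product at a monomial in \<open>k\<close> variables is
  \<open>(1 - q)^k\<close>, so its part of degree \<open>r\<close> is \<open>1 - q\<close> times the quantum power sum, while \<open>R\<^sub>1\<^sub>,\<^sub>q\<close> and
  \<open>R\<^sub>q\<^sub>,\<^sub>1\<close> supply the weights of \<open>\<lambda>\<^sup>+/\<lambda>\<close> and \<open>\<mu>/\<mu>\<^sup>-\<close>.
  Degrees determine \<open>r\<close>, so comparing coefficients of a single monomial picks out the right pairs.
\<close>

section \<open>Partitions as sequences of rows\<close>

text \<open>
  Rows are counted from \<open>0\<close> here, so that a partition becomes a weakly decreasing sequence indexed
  by all natural numbers.
\<close>

abbreviation row :: "nat list \<Rightarrow> nat \<Rightarrow> nat" where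
  "row la i \<equiv> part la (Suc i)"

lemma row_nth: "row la i = (if i < length la then la ! i else 0)"
  by (simp add: part_def)

lemma row_beyond_length [simp]: "length la \<le> i \<Longrightarrow> row la i = 0"
  by (simp add: row_nth)

lemma row_pos_iff: "is_partition la \<Longrightarrow> 0 < row la i \<longleftrightarrow> i < length la"
  unfolding is_partition_def row_nth by (auto intro!: gr0I dest: nth_mem)

lemma row_antimono: "is_partition la \<Longrightarrow> i \<le> j \<Longrightarrow> row la j \<le> row la i"
  unfolding is_partition_def row_nth
  by (cases "i = j") (auto simp: sorted_wrt_iff_nth_less)

lemma partition_eqI:
  assumes "is_partition la" "is_partition mu" "\<And>i. row la i = row mu i"
  shows "la = mu"
proof (rule nth_equalityI)
  show len: "length la = length mu"
    by (metis assms linorder_neqE_nat row_pos_iff less_irrefl)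
  show "la ! i = mu ! i" if "i < length la" for i
    using assms(3)[of i] that len by (simp add: row_nth)
qed

text \<open>
  Rows after the first zero are cut off, so the prescribed lengths are attained only for a weakly
  decreasing sequence that reaches \<open>0\<close>.
\<close>

definition partition_of :: "(nat \<Rightarrow> nat) \<Rightarrow> nat list" where
  "partition_of f = map f [0..<(LEAST n. f n = 0)]"

lemma partition_of:
  assumes dec: "\<And>i. f (Suc i) \<le> f i" and z: "f n = 0"
  shows "is_partition (partition_of f)" and "row (partition_of f) i = f i"
proof -
  let ?l = "LEAST n. f n = 0"
  have anti: "f j \<le> f i" if "i \<le> j" for i j
    by (rule lift_Suc_antimono_le[of f]) (use dec that in auto)
  have l: "f ?l = 0" using z by (rule LeastI)
  have pos: "f i \<noteq> 0" if "i < ?l" for i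
    using not_less_Least that by blast
  show "is_partition (partition_of f)"
    unfolding is_partition_def partition_of_def
    by (auto simp: sorted_wrt_map sorted_wrt_iff_nth_less anti dest: pos)
  show "row (partition_of f) i = f i"
    using anti[of ?l i] l by (simp add: partition_of_def row_nth)
qed

lemma sum_list_rows: "length la \<le> n \<Longrightarrow> sum_list la = (\<Sum>i<n. row la i)"
proof -
  assume "length la \<le> n"
  then have "(\<Sum>i<n. row la i) = (\<Sum>i<length la. row la i)"
    by (intro sum.mono_neutral_right) auto
  also have "\<dots> = (\<Sum>i<length la. la ! i)"
    by (intro sum.cong) (auto simp: row_nth)
  finally show ?thesis by (simp add: sum_list_sum_nth lessThan_atLeast0)
qed

lemma contained_rows: "mu \<subseteq>\<^sub>p la \<longleftrightarrow> (\<forall>i. row mu i \<le> row la i)"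
proof -
  have "i \<ge> 1 \<longleftrightarrow> (\<exists>k. i = Suc k)" for i :: nat
    by (cases i) auto
  then show ?thesis unfolding contained_def by auto
qed

lemma contained_size: "mu \<subseteq>\<^sub>p la \<Longrightarrow> sum_list mu \<le> sum_list la"
  by (simp add: contained_rows sum_list_rows[of _ "length mu + length la"] sum_mono)

lemma contained_refl [simp]: "la \<subseteq>\<^sub>p la"
  by (simp add: contained_rows)

lemma contained_trans: "ka \<subseteq>\<^sub>p mu \<Longrightarrow> mu \<subseteq>\<^sub>p la \<Longrightarrow> ka \<subseteq>\<^sub>p la"
  unfolding contained_rows using order_trans by blast

lemma contained_length: "is_partition mu \<Longrightarrow> mu \<subseteq>\<^sub>p la \<Longrightarrow> length mu \<le> length la"
  using row_pos_iff[of mu "length la"] unfolding contained_rows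
  by (metis leI le_zero_eq less_irrefl order_refl row_beyond_length)

lemma contained_same_size:
  assumes "is_partition la" "is_partition mu" "mu \<subseteq>\<^sub>p la" "sum_list mu = sum_list la"
  shows "mu = la"
proof (rule partition_eqI[OF assms(2,1)])
  fix i
  let ?n = "Suc i + length mu + length la"
  have "(\<Sum>i<?n. row mu i) = (\<Sum>i<?n. row la i)"
    using assms(4) sum_list_rows[of mu ?n] sum_list_rows[of la ?n] by simp
  then show "row mu i = row la i"
    using sum_mono_inv[of "row mu" "{..<?n}" "row la" i] assms(3) by (simp add: contained_rows)
qed

text \<open>
  All matrix products below are sums over \<open>partitions_le N\<close> with \<open>N\<close> so large that every non-zero
  term is covered; a finite index set avoids any notion of convergence.
\<close>

definition partitions_le :: "nat \<Rightarrow> nat list set" where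
  "partitions_le N = {nu. is_partition nu \<and> sum_list nu \<le> N}"

lemma finite_partitions_le_set [simp]: "finite (partitions_le N)"
  by (simp add: partitions_le_def finite_partitions_le)

lemma partitions_leD: "la \<in> partitions_le N \<Longrightarrow> is_partition la"
  by (simp add: partitions_le_def)

lemma partitions_leI: "is_partition mu \<Longrightarrow> mu \<subseteq>\<^sub>p la \<Longrightarrow> sum_list la \<le> N \<Longrightarrow> mu \<in> partitions_le N"
  using contained_size by (fastforce simp: partitions_le_def)

section \<open>Horizontal strips and ribbon weights\<close>

text \<open>
  In terms of rows, having at most one cell in each column means that the row lengths of the two
  partitions interlace.
\<close>

definition horizontal_strip :: "nat list \<Rightarrow> nat list \<Rightarrow> bool" where
  "horizontal_strip ga la \<longleftrightarrow> (\<forall>i. row ga (Suc i) \<le> row la i \<and> row la i \<le> row ga i)"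

lemma horizontal_strip_contained: "horizontal_strip ga la \<Longrightarrow> la \<subseteq>\<^sub>p ga"
  by (simp add: horizontal_strip_def contained_rows)

lemma horizontal_strip_refl [simp]: "is_partition la \<Longrightarrow> horizontal_strip la la"
  by (simp add: horizontal_strip_def row_antimono)

definition strip_weight :: "'a::comm_ring_1 \<Rightarrow> nat list \<Rightarrow> nat list \<Rightarrow> 'a" where
  "strip_weight t ga la = (if horizontal_strip ga la then t ^ (sum_list ga - sum_list la) else 0)"

text \<open>
  The coefficient of the \<open>c\<close>-th power of \<open>x\<close> in \<open>U\<^sub>x\<close>.  The variables of a Schur function enter through
  these coefficients, whereas \<open>s\<close> and \<open>t\<close> are ring elements.
\<close>

definition strip_of_size :: "nat \<Rightarrow> nat list \<Rightarrow> nat list \<Rightarrow> 'a::comm_ring_1" where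
  "strip_of_size c ga la = of_bool (horizontal_strip ga la \<and> sum_list ga = sum_list la + c)"

text \<open>
  The contribution to \<open>R\<^sub>s\<^sub>,\<^sub>t\<close> of a row that grows from length \<open>l\<close> to \<open>g\<close> while the next row grows to
  length \<open>g'\<close>.  If \<open>g' > l + 1\<close> there is a two by two block; if \<open>g' = l + 1\<close> the row
  is joined to the next one by a single column and counts for the height; otherwise a non-empty row is
  the bottom row of a component.  In the last two cases each further cell adds a column.
\<close>

definition row_factor :: "'a::comm_ring_1 \<Rightarrow> 'a \<Rightarrow> nat \<Rightarrow> nat \<Rightarrow> nat \<Rightarrow> 'a" where
  "row_factor s t l g g' =
     (if g' > Suc l then 0 else if g = l then 1
      else if g' = Suc l then - t * s ^ (g - Suc l) else (s - t) * s ^ (g - Suc l))"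

definition ribbon_weight :: "'a::comm_ring_1 \<Rightarrow> 'a \<Rightarrow> nat list \<Rightarrow> nat list \<Rightarrow> 'a" where
  "ribbon_weight s t ga la =
     (if la \<subseteq>\<^sub>p ga then \<Prod>i<length ga. row_factor s t (row la i) (row ga i) (row ga (Suc i)) else 0)"

text \<open>
  \<open>U\<^sub>t\<close> is unitriangular with respect to size, so no non-zero row vector is annihilated by it.  This
  stands in for inverting \<open>U\<^sub>t\<close>.
\<close>

lemma cancel_strip_weight:
  fixes f :: "nat list \<Rightarrow> 'a::comm_ring_1"
  assumes zero: "\<And>ka. ka \<in> partitions_le N \<Longrightarrow> (\<Sum>la\<in>partitions_le N. f la * strip_weight t la ka) = 0"
    and "la \<in> partitions_le N"
  shows "f la = 0"
  using assms(2)
proof (induction "N - sum_list la" arbitrary: la rule: less_induct)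
  case less
  have "(\<Sum>mu\<in>partitions_le N. f mu * strip_weight t mu la) = (\<Sum>mu\<in>{la}. f mu * strip_weight t mu la)"
  proof (rule sum.mono_neutral_right)
    show "\<forall>mu\<in>partitions_le N - {la}. f mu * strip_weight t mu la = 0"
    proof
      fix mu assume mu: "mu \<in> partitions_le N - {la}"
      show "f mu * strip_weight t mu la = 0"
      proof (cases "horizontal_strip mu la")
        case True
        then have "la \<subseteq>\<^sub>p mu" by (rule horizontal_strip_contained)
        with mu less.prems contained_size[OF this] contained_same_size[of mu la]
        have "sum_list la < sum_list mu" "sum_list mu \<le> N"
          by (fastforce simp: partitions_le_def)+
        then have "f mu = 0" using mu by (intro less.hyps) auto
        then show ?thesis by simp
      qed (simp add: strip_weight_def)
    qed
  qed (use less.prems in auto)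
  with zero[OF less.prems] show ?case
    using less.prems by (simp add: strip_weight_def partitions_le_def)
qed

section \<open>Ribbon weights as quotients of strip weights\<close>

lemma sum_swap_inner:
  fixes f :: "'i \<Rightarrow> 'j \<Rightarrow> 'k \<Rightarrow> 'a::comm_monoid_add"
  shows "(\<Sum>i\<in>A. \<Sum>j\<in>B. \<Sum>k\<in>C. f i j k) = (\<Sum>j\<in>B. \<Sum>k\<in>C. \<Sum>i\<in>A. f i j k)"
  by (subst sum.swap[of _ B], intro sum.cong refl, rule sum.swap)

text \<open>
  If the intervals allowed for consecutive rows have at most an end point in common, then any choice of
  row lengths is a partition, and a sum of products over rows becomes a product of sums.
\<close>

lemma sum_box_of_partitions:
  fixes f :: "nat \<Rightarrow> nat \<Rightarrow> 'a::comm_semiring_1"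
  assumes inter: "\<And>i. up (Suc i) \<le> lo i" and zero: "\<And>i. n \<le> i \<Longrightarrow> lo i = 0 \<and> up i = 0"
  shows "(\<Sum>ka | is_partition ka \<and> (\<forall>i. row ka i \<in> {lo i..up i}). \<Prod>i<n. f i (row ka i))
    = (\<Prod>i<n. \<Sum>k=lo i..up i. f i k)" (is "sum ?g ?B = _")
proof -
  let ?ext = "\<lambda>g i. if i < n then g i else 0 :: nat"
  have "sum ?g ?B = (\<Sum>g\<in>PiE {..<n} (\<lambda>i. {lo i..up i}). \<Prod>i<n. f i (g i))"
  proof (rule sum.reindex_bij_witness[where j = "\<lambda>ka. restrict (row ka) {..<n}"
        and i = "\<lambda>g. partition_of (?ext g)"])
    fix ka assume ka: "ka \<in> ?B"
    then have z: "row ka i = 0" if "n \<le> i" for i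
      using zero[OF that] spec[of "\<lambda>i. row ka i \<in> {lo i..up i}" i] by simp
    have eq: "?ext (restrict (row ka) {..<n}) = row ka"
      using z by auto
    have dec: "row ka (Suc i) \<le> row ka i" for i
      using ka by (intro row_antimono) auto
    show "partition_of (?ext (restrict (row ka) {..<n})) = ka"
      unfolding eq
      by (rule partition_eqI) (use partition_of[of "row ka", OF dec z[OF order_refl]] ka in auto)
    show "restrict (row ka) {..<n} \<in> PiE {..<n} (\<lambda>i. {lo i..up i})"
      using ka by auto
    show "(\<Prod>i<n. f i (restrict (row ka) {..<n} i)) = (\<Prod>i<n. f i (row ka i))"
      by (rule prod.cong) auto
  next
    fix g assume g: "g \<in> PiE {..<n} (\<lambda>i. {lo i..up i})"
    then have mem: "?ext g i \<in> {lo i..up i}" for i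
      using zero[of i] by (auto simp: PiE_iff)
    have dec: "?ext g (Suc i) \<le> ?ext g i" for i
      using mem[of i] mem[of "Suc i"] inter[of i] unfolding atLeastAtMost_iff by linarith
    have z: "?ext g n = 0" by simp
    note p = partition_of[of "?ext g", OF dec z]
    show "restrict (row (partition_of (?ext g))) {..<n} = g"
      unfolding p(2) using g by (auto simp: fun_eq_iff PiE_iff extensional_def)
    show "partition_of (?ext g) \<in> ?B"
      unfolding mem_Collect_eq p(2) using p(1) mem by blast
  qed
  also have "\<dots> = (\<Prod>i<n. \<Sum>k=lo i..up i. f i k)"
    by (rule prod_sum_PiE[symmetric]) auto
  finally show ?thesis .
qed

text \<open>
  The sum telescopes: added up from the largest index downwards, the terms from \<open>k\<close> on give
  \<open>t ^ (k - l) * s ^ (g - k)\<close> as long as \<open>g' \<le> k\<close>, and the term with \<open>k + 1 = g'\<close> cancels everything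
  above it.
\<close>

lemma row_factor_sum:
  assumes "l \<le> g" "g' \<le> g"
  shows "(\<Sum>k=l..g. row_factor s t k g g' * t ^ (k - l)) = (if g' \<le> l then s ^ (g - l) else 0)"
  using assms(1)
proof (induction rule: inc_induct)
  case base
  then show ?case using assms(2) by (simp add: row_factor_def)
next
  case (step l)
  have "(\<Sum>k=l..g. row_factor s t k g g' * t ^ (k - l)) =
      row_factor s t l g g' + (\<Sum>k=Suc l..g. row_factor s t k g g' * t ^ (k - l))"
    using step.hyps by (simp add: sum.atLeast_Suc_atMost)
  also have "(\<Sum>k=Suc l..g. row_factor s t k g g' * t ^ (k - l)) =
      t * (\<Sum>k=Suc l..g. row_factor s t k g g' * t ^ (k - Suc l))"
    unfolding sum_distrib_left
  proof (rule sum.cong[OF refl])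
    fix k assume "k \<in> {Suc l..g}"
    then have "k - l = Suc (k - Suc l)" by auto
    then show "row_factor s t k g g' * t ^ (k - l) = t * (row_factor s t k g g' * t ^ (k - Suc l))"
      by (simp only: power_Suc mult.left_commute)
  qed
  also note step.IH
  also have "row_factor s t l g g' + t * (if g' \<le> Suc l then s ^ (g - Suc l) else 0) =
      (if g' \<le> l then s ^ (g - l) else 0)"
  proof -
    have "s ^ (g - l) = s * s ^ (g - Suc l)"
      using step.hyps by (simp flip: power_Suc Suc_diff_Suc)
    then show ?thesis
      using step.hyps by (auto simp: row_factor_def algebra_simps)
  qed
  finally show ?case .
qed

lemma size_diff_rows:
  assumes "la \<subseteq>\<^sub>p ka" "length ka \<le> n" "length la \<le> n"
  shows "sum_list ka - sum_list la = (\<Sum>i<n. row ka i - row la i)"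
  unfolding sum_list_rows[OF assms(2)] sum_list_rows[OF assms(3)]
  by (rule sum_subtractf_nat[symmetric]) (use assms(1) in \<open>auto simp: contained_rows\<close>)

text \<open>
  This is \<open>R\<^sub>s\<^sub>,\<^sub>t U\<^sub>t = U\<^sub>s\<close>.  For fixed \<open>ga\<close> and \<open>la\<close> the conditions on \<open>ka\<close> and the weight both
  decouple into the single rows of \<open>ka\<close>.  If \<open>ga/la\<close> is a horizontal strip, each row contributes a
  geometric sum; otherwise one row contributes zero.
\<close>

lemma ribbon_weight_times_strip_weight:
  fixes s t :: "'a::comm_ring_1"
  assumes ga: "ga \<in> partitions_le N" and la: "is_partition la"
  shows "(\<Sum>ka\<in>partitions_le N. ribbon_weight s t ga ka * strip_weight t ka la) = strip_weight s ga la"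
proof (cases "la \<subseteq>\<^sub>p ga")
  case False
  then have "ribbon_weight s t ga ka * strip_weight t ka la = 0" for ka
    using contained_trans[of la ka ga] horizontal_strip_contained[of ka la]
    by (auto simp: ribbon_weight_def strip_weight_def)
  then show ?thesis
    using False horizontal_strip_contained[of ga la] by (auto simp: strip_weight_def)
next
  case True
  have pga: "is_partition ga" and sga: "sum_list ga \<le> N"
    using ga by (auto simp: partitions_le_def)
  define n where "n = length ga"
  \<comment> \<open>row \<open>i\<close> of \<open>ka\<close> lies below \<open>ga\<close> and, \<open>ka/la\<close> being a horizontal strip, below row \<open>i - 1\<close> of \<open>la\<close>\<close>
  define up where "up i = (case i of 0 \<Rightarrow> row ga 0 | Suc j \<Rightarrow> min (row ga (Suc j)) (row la j))" for i
  have lla: "length la \<le> n"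
    using contained_length[OF la True] by (simp add: n_def)
  let ?B = "{ka. is_partition ka \<and> (\<forall>i. row ka i \<in> {row la i..up i})}"
  let ?f = "\<lambda>i k. row_factor s t k (row ga i) (row ga (Suc i)) * t ^ (k - row la i)"
  have box: "ka \<in> ?B \<longleftrightarrow> is_partition ka \<and> ka \<subseteq>\<^sub>p ga \<and> horizontal_strip ka la" for ka
  proof -
    have "(\<forall>i. row ka i \<in> {row la i..up i}) \<longleftrightarrow>
        (\<forall>i. row la i \<le> row ka i \<and> row ka i \<le> row ga i \<and> row ka (Suc i) \<le> row la i)"
      by (auto simp: up_def split: nat.splits) (metis not0_implies_Suc)+
    then show ?thesis
      by (auto simp: contained_rows horizontal_strip_def)
  qed
  have "(\<Sum>ka\<in>partitions_le N. ribbon_weight s t ga ka * strip_weight t ka la) =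
      (\<Sum>ka\<in>?B. ribbon_weight s t ga ka * strip_weight t ka la)"
  proof (rule sum.mono_neutral_right)
    show "?B \<subseteq> partitions_le N"
      using sga unfolding subset_iff box by (blast intro: partitions_leI)
    show "\<forall>ka\<in>partitions_le N - ?B. ribbon_weight s t ga ka * strip_weight t ka la = 0"
    proof
      fix ka assume "ka \<in> partitions_le N - ?B"
      then have "\<not> (ka \<subseteq>\<^sub>p ga \<and> horizontal_strip ka la)"
        unfolding Diff_iff box using partitions_leD by blast
      then show "ribbon_weight s t ga ka * strip_weight t ka la = 0"
        by (auto simp: ribbon_weight_def strip_weight_def)
    qed
  qed simp
  also have "\<dots> = (\<Sum>ka\<in>?B. \<Prod>i<n. ?f i (row ka i))"
  proof (rule sum.cong[OF refl])
    fix ka assume "ka \<in> ?B"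
    then have ka: "is_partition ka" "ka \<subseteq>\<^sub>p ga" "horizontal_strip ka la" by (simp_all only: box)
    have "sum_list ka - sum_list la = (\<Sum>i<n. row ka i - row la i)"
      using contained_length[OF ka(1,2)] lla horizontal_strip_contained[OF ka(3)]
      by (intro size_diff_rows) (auto simp: n_def)
    then show "ribbon_weight s t ga ka * strip_weight t ka la = (\<Prod>i<n. ?f i (row ka i))"
      using ka by (simp add: ribbon_weight_def strip_weight_def prod.distrib power_sum n_def)
  qed
  also have "\<dots> = (\<Prod>i<n. \<Sum>k=row la i..up i. ?f i k)"
  proof (rule sum_box_of_partitions)
    show "up (Suc i) \<le> row la i" for i by (simp add: up_def)
    show "n \<le> i \<Longrightarrow> row la i = 0 \<and> up i = 0" for i
      using lla by (auto simp: up_def n_def split: nat.split)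
  qed
  also have "\<dots> = strip_weight s ga la"
  proof (cases "horizontal_strip ga la")
    case hs: True
    have "up i = row ga i" for i
      using hs by (auto simp: up_def horizontal_strip_def split: nat.split)
    then have "(\<Sum>k=row la i..up i. ?f i k) = s ^ (row ga i - row la i)" for i
      using hs row_factor_sum[of "row la i" "row ga i" "row ga (Suc i)" s t] row_antimono[OF pga, of i "Suc i"]
      by (simp add: horizontal_strip_def)
    then show ?thesis
      using hs size_diff_rows[OF True, of n] lla by (simp add: strip_weight_def power_sum n_def)
  next
    case nhs: False
    \<comment> \<open>for the topmost offending row, the row of \<open>la\<close> above imposes no bound beyond that of \<open>ga\<close>, so the complete sum of \<open>row_factor_sum\<close> occurs\<close>
    define i0 where "i0 = (LEAST i. row la i < row ga (Suc i))"
    have ex: "\<exists>i. row la i < row ga (Suc i)"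
      using nhs True unfolding horizontal_strip_def contained_rows by (meson not_le)
    then have i0: "row la i0 < row ga (Suc i0)"
      unfolding i0_def by (rule LeastI_ex)
    have minimal: "row ga (Suc i) \<le> row la i" if "i < i0" for i
      using that not_less_Least i0_def by fastforce
    have "Suc i0 < length ga"
      using i0 row_pos_iff[OF pga] by (metis gr_implies_not0 neq0_conv)
    moreover have "up i0 = row ga i0"
      using minimal by (auto simp: up_def split: nat.split)
    then have "(\<Sum>k=row la i0..up i0. ?f i0 k) = 0"
      using i0 row_factor_sum[of "row la i0" "row ga i0" "row ga (Suc i0)" s t] True
        row_antimono[OF pga, of i0 "Suc i0"]
      by (simp add: contained_rows)
    ultimately have "(\<Prod>i<n. \<Sum>k=row la i..up i. ?f i k) = 0"
      by (intro prod_zero) (auto simp: n_def intro!: bexI[of _ i0])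
    then show ?thesis using nhs by (simp add: strip_weight_def)
  qed
  finally show ?thesis .
qed

text \<open>
  Multiplying \<open>R\<^sub>t\<^sub>,\<^sub>s R\<^sub>s\<^sub>,\<^sub>t\<close> by \<open>U\<^sub>t\<close> from the right gives \<open>R\<^sub>t\<^sub>,\<^sub>s U\<^sub>s = U\<^sub>t\<close>, and \<open>U\<^sub>t\<close> can be
  cancelled.
\<close>

lemma ribbon_weight_inverse:
  fixes s t :: "'a::comm_ring_1"
  assumes mu: "mu \<in> partitions_le N" and la: "la \<in> partitions_le N"
  shows "(\<Sum>nu\<in>partitions_le N. ribbon_weight t s mu nu * ribbon_weight s t nu la) = of_bool (mu = la)"
proof -
  let ?P = "partitions_le N"
  let ?f = "\<lambda>la. (\<Sum>nu\<in>?P. ribbon_weight t s mu nu * ribbon_weight s t nu la) - of_bool (mu = la)"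
  have "?f la = 0"
  proof (rule cancel_strip_weight[of N ?f t, OF _ la])
    fix ka assume ka: "ka \<in> ?P"
    have "(\<Sum>la\<in>?P. ?f la * strip_weight t la ka) =
        (\<Sum>la\<in>?P. \<Sum>nu\<in>?P. ribbon_weight t s mu nu * (ribbon_weight s t nu la * strip_weight t la ka)) -
        (\<Sum>la\<in>?P. if la = mu then strip_weight t la ka else 0)"
      unfolding sum_subtractf[symmetric]
      by (intro sum.cong) (auto simp: sum_distrib_right left_diff_distrib mult.assoc)
    also have "(\<Sum>la\<in>?P. \<Sum>nu\<in>?P. ribbon_weight t s mu nu * (ribbon_weight s t nu la * strip_weight t la ka)) =
        (\<Sum>nu\<in>?P. ribbon_weight t s mu nu * strip_weight s nu ka)"
      by (subst sum.swap, intro sum.cong refl)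
        (use ka in \<open>simp add: ribbon_weight_times_strip_weight partitions_leD flip: sum_distrib_left\<close>)
    also have "\<dots> = strip_weight t mu ka"
      using ka mu by (intro ribbon_weight_times_strip_weight) (auto simp: partitions_le_def)
    also have "(\<Sum>la\<in>?P. if la = mu then strip_weight t la ka else 0) = strip_weight t mu ka"
      using mu by simp
    finally show "(\<Sum>la\<in>?P. ?f la * strip_weight t la ka) = 0" by simp
  qed
  then show ?thesis by simp
qed

section \<open>Commutation with horizontal strips\<close>

text \<open>
  The next lemmas compare the partitions \<open>ga\<close> from which both \<open>ka\<close> and \<open>nu\<close> arise by removing a
  horizontal strip with the partitions \<open>si\<close> that arise from both in this way.  Rows \<open>j + 1\<close> of \<open>ga\<close>
  and \<open>j\<close> of \<open>si\<close> are confined to the same interval, with end points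
  \<open>max (row ka (j + 1)) (row nu (j + 1))\<close> and \<open>min (row ka j) (row nu j)\<close>, so reflecting this interval
  exchanges them.  The top row of \<open>ga\<close> has no upper bound and is recovered from the size.
\<close>

lemma toggle_size:
  assumes tog: "\<And>j. row ga (Suc j) + row si j =
      max (row ka (Suc j)) (row nu (Suc j)) + min (row ka j) (row nu j)"
  shows "sum_list ga + sum_list si + max (row ka 0) (row nu 0) = row ga 0 + sum_list ka + sum_list nu"
proof -
  define n where "n = length ga + length si + length ka + length nu"
  have shift: "(\<Sum>i<Suc n. f i) = f 0 + (\<Sum>i<n. f (Suc i))" for f :: "nat \<Rightarrow> nat"
    by (rule sum.lessThan_Suc_shift)
  have "sum_list ga + sum_list si + max (row ka 0) (row nu 0) =
      row ga 0 + (\<Sum>j<n. row ga (Suc j) + row si j) + max (row ka 0) (row nu 0)"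
    using sum_list_rows[of ga "Suc n"] sum_list_rows[of si n] shift[of "row ga"]
    by (simp only: sum.distrib) (simp add: n_def)
  also have "(\<Sum>j<n. row ga (Suc j) + row si j) =
      (\<Sum>j<n. max (row ka (Suc j)) (row nu (Suc j))) + (\<Sum>j<n. min (row ka j) (row nu j))"
    by (simp add: tog sum.distrib)
  also have "row ga 0 + \<dots> + max (row ka 0) (row nu 0) =
      row ga 0 + (\<Sum>j<Suc n. max (row ka j) (row nu j)) + (\<Sum>j<Suc n. min (row ka j) (row nu j))"
    by (subst shift[of "\<lambda>j. max (row ka j) (row nu j)"]) (simp add: n_def)
  \<comment> \<open>maximum and minimum of two numbers have the same sum as the numbers\<close>
  also have "\<dots> = row ga 0 + (\<Sum>j<Suc n. row ka j + row nu j)"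
    by (simp add: sum.distrib[symmetric] min_def max_def del: sum.lessThan_Suc
        cong: if_cong sum.cong) (intro sum.cong, auto)
  also have "\<dots> = row ga 0 + sum_list ka + sum_list nu"
    using sum_list_rows[of ka "Suc n"] sum_list_rows[of nu "Suc n"]
    by (simp add: n_def sum.distrib del: sum.lessThan_Suc)
  finally show ?thesis .
qed

lemma card_common_strips:
  assumes ka: "is_partition ka" and nu: "is_partition nu"
  shows "card {ga. is_partition ga \<and> horizontal_strip ga ka \<and> horizontal_strip ga nu \<and>
                   sum_list ga = sum_list nu + c} =
         card {si. is_partition si \<and> horizontal_strip ka si \<and> horizontal_strip nu si \<and>
                   sum_list ka \<le> sum_list si + c}" (is "card ?A = card ?B")
proof -
  \<comment> \<open>the reflection of the interval for row \<open>j\<close>\<close>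
  define tog where "tog j k = max (row ka (Suc j)) (row nu (Suc j)) + min (row ka j) (row nu j) - k" for j k
  define down where "down ga = partition_of (\<lambda>j. tog j (row ga (Suc j)))" for ga
  define up where "up si = partition_of (\<lambda>i. case i of
      0 \<Rightarrow> max (row ka 0) (row nu 0) + (c + sum_list si - sum_list ka) | Suc j \<Rightarrow> tog j (row si j))" for si
  have A: "ga \<in> ?A \<longleftrightarrow> is_partition ga \<and> sum_list ga = sum_list nu + c \<and>
      row ka 0 \<le> row ga 0 \<and> row nu 0 \<le> row ga 0 \<and>
      (\<forall>j. row ga (Suc j) \<in> {max (row ka (Suc j)) (row nu (Suc j))..min (row ka j) (row nu j)})" for ga
  proof -
    have "(\<forall>i. row x i \<le> row ga i) \<longleftrightarrow> row x 0 \<le> row ga 0 \<and> (\<forall>j. row x (Suc j) \<le> row ga (Suc j))" for x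
      by (metis not0_implies_Suc)
    then show ?thesis
      unfolding horizontal_strip_def all_conj_distrib mem_Collect_eq atLeastAtMost_iff
        max.bounded_iff min.bounded_iff
      by blast
  qed
  have B: "si \<in> ?B \<longleftrightarrow> is_partition si \<and> sum_list ka \<le> sum_list si + c \<and>
      (\<forall>j. row si j \<in> {max (row ka (Suc j)) (row nu (Suc j))..min (row ka j) (row nu j)})" for si
    unfolding horizontal_strip_def by auto
  have tog_mem: "tog j k \<in> {max (row ka (Suc j)) (row nu (Suc j))..min (row ka j) (row nu j)}"
    and tog_tog: "tog j (tog j k) = k"
    and tog_add: "tog j k + k = max (row ka (Suc j)) (row nu (Suc j)) + min (row ka j) (row nu j)"
    if "k \<in> {max (row ka (Suc j)) (row nu (Suc j))..min (row ka j) (row nu j)}" for j k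
    using that by (auto simp: tog_def)
  have far: "tog j k = 0" if "length ka + length nu \<le> j" for j k
    using that by (simp add: tog_def)
  have down: "is_partition (down ga)" "row (down ga) j = tog j (row ga (Suc j))" if "ga \<in> ?A" for ga j
  proof -
    have "tog (Suc j) (row ga (Suc (Suc j))) \<le> tog j (row ga (Suc j))" for j
      using that tog_mem[of "row ga (Suc j)" j] tog_mem[of "row ga (Suc (Suc j))" "Suc j"]
      unfolding A by force
    from partition_of[of "\<lambda>j. tog j (row ga (Suc j))", OF this far[OF order_refl]]
    show "is_partition (down ga)" "row (down ga) j = tog j (row ga (Suc j))"
      by (simp_all add: down_def)
  qed
  have up: "is_partition (up si)" "row (up si) (Suc j) = tog j (row si j)"
      "row (up si) 0 = max (row ka 0) (row nu 0) + (c + sum_list si - sum_list ka)"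
    if "si \<in> ?B" for si j
  proof -
    let ?f = "\<lambda>i. case i of
      0 \<Rightarrow> max (row ka 0) (row nu 0) + (c + sum_list si - sum_list ka) | Suc j \<Rightarrow> tog j (row si j)"
    have m: "tog j (row si j) \<in> {max (row ka (Suc j)) (row nu (Suc j))..min (row ka j) (row nu j)}" for j
      using that tog_mem unfolding B by blast
    have dec: "?f (Suc i) \<le> ?f i" for i
    proof (cases i)
      case 0
      show ?thesis using m[of 0] by (auto simp: 0)
    next
      case (Suc j)
      show ?thesis using m[of j] m[of "Suc j"] by (auto simp: Suc)
    qed
    have "?f (Suc (length ka + length nu)) = 0"
      by (simp add: far)
    note p = partition_of[of ?f, OF dec this, folded up_def]
    show "is_partition (up si)" "row (up si) (Suc j) = tog j (row si j)"
      "row (up si) 0 = max (row ka 0) (row nu 0) + (c + sum_list si - sum_list ka)"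
      using p by simp_all
  qed
  have size_down: "c + sum_list (down ga) + max (row ka 0) (row nu 0) = row ga 0 + sum_list ka"
    if "ga \<in> ?A" for ga
  proof -
    have "sum_list ga + sum_list (down ga) + max (row ka 0) (row nu 0) = row ga 0 + sum_list ka + sum_list nu"
    proof (rule toggle_size)
      show "row ga (Suc j) + row (down ga) j =
          max (row ka (Suc j)) (row nu (Suc j)) + min (row ka j) (row nu j)" for j
        using that tog_add[of "row ga (Suc j)" j] unfolding down(2)[OF that] A by simp
    qed
    then show ?thesis using that by simp
  qed
  have size_up: "sum_list (up si) = sum_list nu + c" if "si \<in> ?B" for si
  proof -
    have "sum_list (up si) + sum_list si + max (row ka 0) (row nu 0) = row (up si) 0 + sum_list ka + sum_list nu"
    proof (rule toggle_size)
      show "row (up si) (Suc j) + row si j =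
          max (row ka (Suc j)) (row nu (Suc j)) + min (row ka j) (row nu j)" for j
        using that tog_add[of "row si j" j] unfolding up(2)[OF that] B by simp
    qed
    then show ?thesis using that up(3)[OF that] by simp
  qed
  have downB: "down ga \<in> ?B" if "ga \<in> ?A" for ga
  proof -
    have "sum_list ka \<le> sum_list (down ga) + c"
      using size_down[OF that] that unfolding A by (auto simp: max_def split: if_splits)
    then show ?thesis
      using down[OF that] tog_mem that unfolding A B by simp
  qed
  have upA: "up si \<in> ?A" if "si \<in> ?B" for si
  proof -
    have "max (row ka 0) (row nu 0) \<le> row (up si) 0"
      by (simp only: up(3)[OF that] le_add1)
    then show ?thesis
      using size_up[OF that] up(1,2)[OF that] tog_mem that unfolding A B by simp
  qed
  have "bij_betw down ?A ?B"
  proof (rule bij_betw_byWitness[where f' = up])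
    show "\<forall>ga\<in>?A. up (down ga) = ga"
    proof
      fix ga assume ga: "ga \<in> ?A"
      show "up (down ga) = ga"
      proof (rule partition_eqI)
        show "is_partition (up (down ga))" using up(1)[OF downB[OF ga]] .
        show "is_partition ga" using ga by simp
        show "row (up (down ga)) i = row ga i" for i
        proof (cases i)
          case 0
          show ?thesis using size_down[OF ga] up(3)[OF downB[OF ga]] downB[OF ga] by (simp add: 0)
        next
          case (Suc j)
          show ?thesis
            using ga up(2)[OF downB[OF ga]] down(2)[OF ga] tog_tog unfolding A by (simp add: Suc)
        qed
      qed
    qed
    show "\<forall>si\<in>?B. down (up si) = si"
    proof
      fix si assume si: "si \<in> ?B"
      show "down (up si) = si"
      proof (rule partition_eqI)
        show "is_partition (down (up si))" using down(1)[OF upA[OF si]] .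
        show "is_partition si" using si by simp
        show "row (down (up si)) i = row si i" for i
          using si down(2)[OF upA[OF si]] up(2)[OF si] tog_tog unfolding B by simp
      qed
    qed
  qed (use downB upA in blast)+
  then show ?thesis by (rule bij_betw_same_card)
qed

text \<open>
  The powers of \<open>t\<close> depend only on sizes, which the bijection behind \<open>card_common_strips\<close> controls.
  Summed against powers of a variable \<open>x\<close>, the identity says
  \<open>U\<^sub>t^T U(x) = 1 / (1 - t * x) * U(x) U\<^sub>t^T\<close>.
\<close>

lemma strips_commute:
  fixes t :: "'a::comm_ring_1"
  assumes ka: "is_partition ka" and nu: "is_partition nu" and N: "sum_list nu + c \<le> N"
  shows "(\<Sum>ga\<in>partitions_le N. strip_of_size c ga nu * strip_weight t ga ka) =
    (\<Sum>e\<le>c. t ^ (c - e) * (\<Sum>si\<in>partitions_le N. strip_of_size e ka si * strip_weight t nu si))"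
proof -
  let ?P = "partitions_le N"
  let ?A = "{ga. is_partition ga \<and> horizontal_strip ga ka \<and> horizontal_strip ga nu \<and>
                   sum_list ga = sum_list nu + c}"
  let ?B = "{si. is_partition si \<and> horizontal_strip ka si \<and> horizontal_strip nu si \<and>
                   sum_list ka \<le> sum_list si + c}"
  let ?x = "t ^ (sum_list nu + c - sum_list ka)"
  have "(\<Sum>ga\<in>?P. strip_of_size c ga nu * strip_weight t ga ka) = (\<Sum>ga\<in>?A. ?x)"
    using N by (intro sum.mono_neutral_cong_right)
      (auto simp: strip_of_size_def strip_weight_def partitions_le_def finite_partitions_le)
  also have "\<dots> = (\<Sum>si\<in>?B. ?x)"
    using card_common_strips[OF ka nu, of c] by simp
  also have "\<dots> = (\<Sum>si\<in>?P. \<Sum>e\<le>c. t ^ (c - e) * (strip_of_size e ka si * strip_weight t nu si))"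
  proof (rule sum.mono_neutral_cong_left)
    show "?B \<subseteq> ?P"
      using N by (auto simp: partitions_le_def dest!: horizontal_strip_contained contained_size)
    show "\<forall>si\<in>?P - ?B. (\<Sum>e\<le>c. t ^ (c - e) * (strip_of_size e ka si * strip_weight t nu si)) = 0"
    proof (intro ballI sum.neutral)
      fix si e assume "si \<in> ?P - ?B" "e \<in> {..c}"
      then have "\<not> (horizontal_strip ka si \<and> sum_list ka = sum_list si + e \<and> horizontal_strip nu si)"
        by (auto simp: partitions_le_def)
      then show "t ^ (c - e) * (strip_of_size e ka si * strip_weight t nu si) = 0"
        unfolding strip_of_size_def strip_weight_def by (auto simp del: mult_eq_0_iff)
    qed
    fix si assume si: "si \<in> ?B"
    define e0 where "e0 = sum_list ka - sum_list si"
    have le: "sum_list si \<le> sum_list ka" "sum_list si \<le> sum_list nu"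
      using si by (auto dest!: horizontal_strip_contained contained_size)
    have "(\<Sum>e\<le>c. t ^ (c - e) * (strip_of_size e ka si * strip_weight t nu si)) =
        (\<Sum>e\<le>c. if e = e0 then t ^ (c - e0) * t ^ (sum_list nu - sum_list si) else 0)"
      using si le by (intro sum.cong) (auto simp: strip_of_size_def strip_weight_def e0_def)
    also have "\<dots> = t ^ (c - e0) * t ^ (sum_list nu - sum_list si)"
      using si by (auto simp: e0_def)
    also have "\<dots> = ?x"
    proof -
      have "c - e0 + (sum_list nu - sum_list si) = sum_list nu + c - sum_list ka"
        using si le by (simp add: e0_def)
      then show ?thesis by (simp flip: power_add)
    qed
    finally show "?x = (\<Sum>e\<le>c. t ^ (c - e) * (strip_of_size e ka si * strip_weight t nu si))" ..
  qed (rule finite_partitions_le_set)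
  also have "\<dots> = (\<Sum>e\<le>c. t ^ (c - e) * (\<Sum>si\<in>?P. strip_of_size e ka si * strip_weight t nu si))"
    by (subst sum.swap) (simp add: sum_distrib_left)
  finally show ?thesis .
qed

text \<open>
  The coefficients of the power series \<open>(1 - t * x) / (1 - s * x)\<close> in \<open>x\<close>.
\<close>

definition exponent_weight :: "'a::comm_ring_1 \<Rightarrow> 'a \<Rightarrow> nat \<Rightarrow> 'a" where
  "exponent_weight s t e = (if e = 0 then 1 else (s - t) * s ^ (e - 1))"

text \<open>
  Multiplying by \<open>1 / (1 - t * x)\<close> leaves \<open>1 / (1 - s * x)\<close>.  The sum is the one of
  \<open>row_factor_sum\<close> without a next row.
\<close>

lemma exponent_weight_convolution:
  assumes "e \<le> c"
  shows "(\<Sum>d=e..c. exponent_weight s t (c - d) * t ^ (d - e)) = s ^ (c - e)"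
proof -
  have "exponent_weight s t (c - d) = row_factor s t d c 0" if "d \<in> {e..c}" for d
    using that by (auto simp: exponent_weight_def row_factor_def)
  then show ?thesis
    using row_factor_sum[OF assms, of 0 s t] by simp
qed

text \<open>
  This is \<open>R\<^sub>s\<^sub>,\<^sub>t^T U(x) = (1 - t * x) / (1 - s * x) * U(x) R\<^sub>s\<^sub>,\<^sub>t^T\<close>, read off at the power \<open>c\<close> of
  \<open>x\<close>.  After multiplication by \<open>U\<^sub>t^T\<close>, which can be cancelled, \<open>R\<^sub>s\<^sub>,\<^sub>t U\<^sub>t = U\<^sub>s\<close> reduces both
  sides to \<open>strips_commute\<close>, for \<open>s\<close> on the left and for \<open>t\<close> on the right; the coefficients then agree by
  \<open>exponent_weight_convolution\<close>.
\<close>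

lemma ribbon_weight_commute:
  fixes s t :: "'a::comm_ring_1"
  assumes nu: "is_partition nu" and N: "sum_list nu + c \<le> N" and la: "la \<in> partitions_le N"
  shows "(\<Sum>ga\<in>partitions_le N. ribbon_weight s t ga la * strip_of_size c ga nu) =
    (\<Sum>d\<le>c. exponent_weight s t (c - d) *
       (\<Sum>rh\<in>partitions_le N. strip_of_size d la rh * ribbon_weight s t nu rh))"
proof -
  let ?P = "partitions_le N" and ?w = "exponent_weight s t" and ?R = "ribbon_weight s t"
  let ?L = "\<lambda>la. \<Sum>ga\<in>?P. ?R ga la * strip_of_size c ga nu"
  let ?M = "\<lambda>la. \<Sum>d\<le>c. ?w (c - d) * (\<Sum>rh\<in>?P. strip_of_size d la rh * ?R nu rh)"
  have nuP: "nu \<in> ?P" using nu N by (simp add: partitions_le_def)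
  have "?L la - ?M la = 0"
  proof (rule cancel_strip_weight[of N "\<lambda>la. ?L la - ?M la" t, OF _ la])
    fix ka assume ka: "ka \<in> ?P"
    then have pka: "is_partition ka" by (simp add: partitions_le_def)
    define X :: "nat \<Rightarrow> 'a" where
      "X e = (\<Sum>si\<in>?P. strip_of_size e ka si * strip_weight s nu si)" for e
    have "(\<Sum>la\<in>?P. ?L la * strip_weight t la ka) =
        (\<Sum>ga\<in>?P. strip_of_size c ga nu * (\<Sum>la\<in>?P. ?R ga la * strip_weight t la ka))"
      unfolding sum_distrib_right sum_distrib_left
      by (subst sum.swap) (simp add: algebra_simps)
    also have "\<dots> = (\<Sum>ga\<in>?P. strip_of_size c ga nu * strip_weight s ga ka)"
      by (intro sum.cong refl arg_cong2[where f = "(*)"] ribbon_weight_times_strip_weight pka)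
    also have "\<dots> = (\<Sum>e\<le>c. s ^ (c - e) * X e)"
      unfolding X_def by (rule strips_commute[OF pka nu N])
    finally have left: "(\<Sum>la\<in>?P. ?L la * strip_weight t la ka) = (\<Sum>e\<le>c. s ^ (c - e) * X e)" .
    have inner: "(\<Sum>rh\<in>?P. ?R nu rh * (\<Sum>la\<in>?P. strip_of_size d la rh * strip_weight t la ka)) =
        (\<Sum>e\<le>d. t ^ (d - e) * X e)" if d: "d \<le> c" for d
    proof -
      have "(\<Sum>rh\<in>?P. ?R nu rh * (\<Sum>la\<in>?P. strip_of_size d la rh * strip_weight t la ka)) =
        (\<Sum>rh\<in>?P. ?R nu rh * (\<Sum>e\<le>d. t ^ (d - e) *
            (\<Sum>si\<in>?P. strip_of_size e ka si * strip_weight t rh si)))"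
      proof (rule sum.cong[OF refl])
        fix rh assume rh: "rh \<in> ?P"
        show "?R nu rh * (\<Sum>la\<in>?P. strip_of_size d la rh * strip_weight t la ka) =
          ?R nu rh * (\<Sum>e\<le>d. t ^ (d - e) * (\<Sum>si\<in>?P. strip_of_size e ka si * strip_weight t rh si))"
        proof (cases "rh \<subseteq>\<^sub>p nu")
          case True
          then have "sum_list rh + d \<le> N"
            using contained_size N d by fastforce
          then show ?thesis
            using rh strips_commute[OF pka, of rh d N t] by (simp add: partitions_le_def)
        qed (simp add: ribbon_weight_def)
      qed
      also have "\<dots> = (\<Sum>rh\<in>?P. \<Sum>e\<le>d. \<Sum>si\<in>?P.
            t ^ (d - e) * (strip_of_size e ka si * (?R nu rh * strip_weight t rh si)))"
        by (simp add: sum_distrib_left algebra_simps)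
      also have "\<dots> = (\<Sum>e\<le>d. \<Sum>si\<in>?P. \<Sum>rh\<in>?P.
            t ^ (d - e) * (strip_of_size e ka si * (?R nu rh * strip_weight t rh si)))"
        by (rule sum_swap_inner)
      also have "\<dots> = (\<Sum>e\<le>d. t ^ (d - e) * X e)"
        unfolding X_def sum_distrib_left
        by (intro sum.cong refl)
          (use nuP in \<open>simp add: ribbon_weight_times_strip_weight partitions_leD flip: sum_distrib_left\<close>)
      finally show ?thesis .
    qed
    have "(\<Sum>la\<in>?P. ?M la * strip_weight t la ka) =
        (\<Sum>la\<in>?P. \<Sum>d\<le>c. \<Sum>rh\<in>?P.
          ?w (c - d) * (?R nu rh * (strip_of_size d la rh * strip_weight t la ka)))"
      by (simp add: sum_distrib_left sum_distrib_right algebra_simps)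
    also have "\<dots> = (\<Sum>d\<le>c. \<Sum>rh\<in>?P. \<Sum>la\<in>?P.
          ?w (c - d) * (?R nu rh * (strip_of_size d la rh * strip_weight t la ka)))"
      by (rule sum_swap_inner)
    also have "\<dots> = (\<Sum>d\<le>c. ?w (c - d) * (\<Sum>e\<le>d. t ^ (d - e) * X e))"
      by (intro sum.cong refl) (simp add: inner flip: sum_distrib_left)
    also have "\<dots> = (\<Sum>d\<le>c. \<Sum>e\<le>d. ?w (c - d) * t ^ (d - e) * X e)"
      by (simp add: sum_distrib_left algebra_simps)
    also have "\<dots> = (\<Sum>e\<le>c. \<Sum>d=e..c. ?w (c - d) * t ^ (d - e) * X e)"
      by (simp add: sum.Sigma) (rule sum.reindex_bij_witness[where i = "\<lambda>(e, d). (d, e)" and j = "\<lambda>(d, e). (e, d)"], auto)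
    also have "\<dots> = (\<Sum>e\<le>c. s ^ (c - e) * X e)"
      by (intro sum.cong refl) (simp add: exponent_weight_convolution flip: sum_distrib_right)
    finally show "(\<Sum>la\<in>?P. (?L la - ?M la) * strip_weight t la ka) = 0"
      using left by (simp add: left_diff_distrib sum_subtractf)
  qed
  then show ?thesis by simp
qed

section \<open>Tableaux and their largest entries\<close>

lemma skew_cell_iff:
  "(i, j) \<in> skew_diagram la mu \<longleftrightarrow> (\<exists>k. i = Suc k \<and> row mu k < j \<and> j \<le> row la k)"
  by (cases i) (auto simp: skew_diagram_def part_def)

lemma skew_cell_Suc [simp]:
  "(Suc k, j) \<in> skew_diagram la mu \<longleftrightarrow> row mu k < j \<and> j \<le> row la k"
  by (simp add: skew_cell_iff)

lemma skew_diagram_mono: "nu \<subseteq>\<^sub>p la \<Longrightarrow> skew_diagram nu mu \<subseteq> skew_diagram la mu"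
  by (force simp: skew_cell_iff contained_rows intro: order_trans)

lemma card_skew_diagram:
  assumes "mu \<subseteq>\<^sub>p la"
  shows "card (skew_diagram la mu) = sum_list la - sum_list mu"
proof -
  let ?n = "length la + length mu"
  have "skew_diagram la mu = (\<lambda>(k, j). (Suc k, j)) ` (SIGMA k:{..<?n}. {row mu k<..row la k})"
    (is "_ = ?f ` ?S")
  proof (rule set_eqI, clarify)
    fix i j
    have "k < ?n" if "row mu k < j" "j \<le> row la k" for k
    proof (rule ccontr)
      assume "\<not> k < ?n"
      then have "row la k = 0" by simp
      with that show False by simp
    qed
    then show "(i, j) \<in> skew_diagram la mu \<longleftrightarrow> (i, j) \<in> ?f ` ?S"
      by (force simp: skew_cell_iff)
  qed
  then have "card (skew_diagram la mu) = card ?S"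
    by (simp add: card_image inj_on_def)
  also have "\<dots> = (\<Sum>k<?n. row la k - row mu k)"
    by (subst card_SigmaI) auto
  also have "\<dots> = sum_list la - sum_list mu"
    by (rule size_diff_rows[symmetric]) (use assms in auto)
  finally show ?thesis .
qed

definition total_degree :: "monomial \<Rightarrow> nat" where
  "total_degree m = (\<Sum>i\<in>vars m. expo m i)"

lemma total_degree_superset: "finite S \<Longrightarrow> vars m \<subseteq> S \<Longrightarrow> total_degree m = (\<Sum>i\<in>S. expo m i)"
  unfolding total_degree_def by (rule sum.mono_neutral_left) (auto simp: in_keys_iff)

lemma total_degree_zero [simp]: "total_degree 0 = 0"
  by (simp add: total_degree_def)

lemma total_degree_plus [simp]: "total_degree (a + b) = total_degree a + total_degree b"
  using total_degree_superset[of "vars a \<union> vars b" a] total_degree_superset[of "vars a \<union> vars b" b]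
    total_degree_superset[of "vars a \<union> vars b" "a + b"] Poly_Mapping.keys_add[of a b]
  by (simp add: lookup_add sum.distrib)

lemma total_degree_single [simp]: "total_degree (Poly_Mapping.single n d) = d"
  using total_degree_superset[of "{n}" "Poly_Mapping.single n d"] by simp

lemma total_degree_sum: "total_degree (\<Sum>x\<in>A. f x) = (\<Sum>x\<in>A. total_degree (f x))"
  by (induction A rule: infinite_finite_induct) auto

lemma total_degree_content:
  "mu \<subseteq>\<^sub>p la \<Longrightarrow> total_degree (content la mu T) = sum_list la - sum_list mu"
  by (simp add: content_def total_degree_sum card_skew_diagram)

lemma entry_in_vars_content:
  assumes "c \<in> skew_diagram la mu"
  shows "T c \<in> vars (content la mu T)"
proof -
  have "expo (content la mu T) (T c) \<ge> expo (Poly_Mapping.single (T c) (1::nat)) (T c)"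
    unfolding content_def lookup_sum
    by (rule member_le_sum[OF assms]) (simp_all add: finite_skew_diagram)
  then show ?thesis by (simp add: in_keys_iff)
qed

lemma sum_single_const: "finite A \<Longrightarrow> (\<Sum>x\<in>A. Poly_Mapping.single n (1::nat)) = Poly_Mapping.single n (card A)"
  by (induction A rule: finite_induct) (auto simp flip: single_add)

lemma content_split:
  assumes "mu \<subseteq>\<^sub>p nu" "nu \<subseteq>\<^sub>p la"
    and small: "\<And>c. c \<in> skew_diagram nu mu \<Longrightarrow> T c = T' c"
    and big: "\<And>c. c \<in> skew_diagram la mu - skew_diagram nu mu \<Longrightarrow> T c = n"
  shows "content la mu T = content nu mu T' + Poly_Mapping.single n (sum_list la - sum_list nu)"
proof -
  let ?D = "skew_diagram la mu" and ?E = "skew_diagram nu mu"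
  have sub: "?E \<subseteq> ?D" using assms(2) by (rule skew_diagram_mono)
  have "content la mu T = (\<Sum>c\<in>?E. Poly_Mapping.single (T c) 1) + (\<Sum>c\<in>?D - ?E. Poly_Mapping.single (T c) 1)"
    unfolding content_def using sum.subset_diff[OF sub finite_skew_diagram] by (simp add: add.commute)
  also have "(\<Sum>c\<in>?E. Poly_Mapping.single (T c) 1) = content nu mu T'"
    unfolding content_def using small by (intro sum.cong) auto
  also have "(\<Sum>c\<in>?D - ?E. Poly_Mapping.single (T c) (1::nat)) = (\<Sum>c\<in>?D - ?E. Poly_Mapping.single n 1)"
    using big by (intro sum.cong) auto
  also have "\<dots> = Poly_Mapping.single n (card (?D - ?E))"
    by (rule sum_single_const) (simp add: finite_skew_diagram)
  also have "card (?D - ?E) = sum_list la - sum_list nu"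
    using card_Diff_subset[OF finite_skew_diagram sub] card_skew_diagram[OF assms(1)]
      card_skew_diagram[OF contained_trans[OF assms(1,2)]] contained_size[OF assms(1)]
    by simp
  finally show ?thesis .
qed

definition tableaux :: "nat list \<Rightarrow> nat list \<Rightarrow> monomial \<Rightarrow> (cell \<Rightarrow> nat) set" where
  "tableaux la mu m = {T \<in> ssyt la mu. content la mu T = m}"

lemma ssytD_row:
  "T \<in> ssyt la mu \<Longrightarrow> (i, j) \<in> skew_diagram la mu \<Longrightarrow> (i, j') \<in> skew_diagram la mu \<Longrightarrow> j < j' \<Longrightarrow>
    T (i, j) \<le> T (i, j')"
  unfolding ssyt_def by blast

lemma ssytD_col:
  "T \<in> ssyt la mu \<Longrightarrow> (i, j) \<in> skew_diagram la mu \<Longrightarrow> (i', j) \<in> skew_diagram la mu \<Longrightarrow> i < i' \<Longrightarrow>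
    T (i, j) < T (i', j)"
  unfolding ssyt_def by blast

definition small_entries_in :: "nat \<Rightarrow> nat list \<Rightarrow> nat list \<Rightarrow> (cell \<Rightarrow> nat) \<Rightarrow> nat list \<Rightarrow> bool" where
  "small_entries_in n la mu T nu \<longleftrightarrow>
     (\<forall>c\<in>skew_diagram la mu. T c < n \<longleftrightarrow> c \<in> skew_diagram nu mu)"

lemma entry_le_top:
  assumes "T \<in> tableaux la mu (a + Poly_Mapping.single n d)" "vars a \<subseteq> {..<n}" "c \<in> skew_diagram la mu"
  shows "T c \<le> n"
proof -
  have "T c \<in> vars (a + Poly_Mapping.single n d)"
    using entry_in_vars_content[OF assms(3), of T] assms(1) by (simp add: tableaux_def)
  then show ?thesis
    using Poly_Mapping.keys_add[of a "Poly_Mapping.single n d"] assms(2) by (auto split: if_splits)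
qed

text \<open>
  Filling \<open>la/nu\<close> with \<open>n\<close> extends a tableau of shape \<open>nu/mu\<close> with smaller entries: columns stay strict
  because \<open>la/nu\<close> has at most one cell in each column.
\<close>

lemma card_tableaux_small_entries_in:
  assumes nu: "is_partition nu" and la: "is_partition la" and mu: "is_partition mu"
    and sub: "mu \<subseteq>\<^sub>p nu" and hs: "horizontal_strip la nu" and size: "sum_list la = sum_list nu + d"
    and a: "vars a \<subseteq> {..<n}"
  shows "card {T \<in> tableaux la mu (a + Poly_Mapping.single n d). small_entries_in n la mu T nu} =
    card (tableaux nu mu a)"
proof -
  let ?D = "skew_diagram la mu" and ?E = "skew_diagram nu mu"
  let ?L = "{T \<in> tableaux la mu (a + Poly_Mapping.single n d). small_entries_in n la mu T nu}"
  let ?ext = "\<lambda>T. restrict (\<lambda>c. if c \<in> ?E then T c else n) ?D"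
  have nula: "nu \<subseteq>\<^sub>p la" by (rule horizontal_strip_contained[OF hs])
  have ED: "?E \<subseteq> ?D" by (rule skew_diagram_mono[OF nula])
  have top: "T c = n" if "T \<in> ?L" "c \<in> ?D - ?E" for T c
    using entry_le_top[of T la mu a n d c] that a by (force simp: small_entries_in_def)
  have small: "T c < n" if "T \<in> tableaux nu mu a" "c \<in> ?E" for T c
    using entry_in_vars_content[OF that(2), of T] that(1) a by (auto simp: tableaux_def)
  have "bij_betw (\<lambda>T. restrict T ?E) ?L (tableaux nu mu a)"
  proof (rule bij_betw_byWitness[where f' = ?ext])
    show "\<forall>T\<in>?L. ?ext (restrict T ?E) = T"
    proof
      fix T assume T: "T \<in> ?L"
      show "?ext (restrict T ?E) = T"
      proof
        fix c
        have "T \<in> extensional ?D" using T by (auto simp: tableaux_def ssyt_def)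
        then show "?ext (restrict T ?E) c = T c"
          using top[OF T, of c] extensional_arb[of T ?D c] by (auto simp: restrict_def)
      qed
    qed
    show "\<forall>T\<in>tableaux nu mu a. restrict (?ext T) ?E = T"
    proof
      fix T assume T: "T \<in> tableaux nu mu a"
      then have "T \<in> extensional ?E" by (auto simp: tableaux_def ssyt_def)
      then show "restrict (?ext T) ?E = T"
        using ED by (auto simp: restrict_def extensional_def fun_eq_iff)
    qed
    show "(\<lambda>T. restrict T ?E) ` ?L \<subseteq> tableaux nu mu a"
    proof (rule image_subsetI)
      fix T assume T: "T \<in> ?L"
      have "content la mu T = content nu mu (restrict T ?E) + Poly_Mapping.single n (sum_list la - sum_list nu)"
        by (rule content_split[OF sub nula]) (use top[OF T] in auto)
      then have "content nu mu (restrict T ?E) = a"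
        using T size by (simp add: tableaux_def)
      moreover have "restrict T ?E \<in> ssyt nu mu"
        using T ED unfolding tableaux_def ssyt_def by (auto simp: subset_iff)
      ultimately show "restrict T ?E \<in> tableaux nu mu a"
        by (simp add: tableaux_def)
    qed
    show "?ext ` tableaux nu mu a \<subseteq> ?L"
    proof (rule image_subsetI)
      fix T assume T: "T \<in> tableaux nu mu a"
      have "content la mu (?ext T) = content nu mu T + Poly_Mapping.single n (sum_list la - sum_list nu)"
        by (rule content_split[OF sub nula]) (use ED in auto)
      then have cont: "content la mu (?ext T) = a + Poly_Mapping.single n d"
        using T size by (simp add: tableaux_def)
      have "?ext T \<in> ssyt la mu"
        unfolding ssyt_def
      proof (intro CollectI conjI allI impI)
        show "?ext T \<in> extensional ?D" by simp
        fix i j j' assume c: "(i, j) \<in> ?D" "(i, j') \<in> ?D" "j < j'"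
        show "?ext T (i, j) \<le> ?ext T (i, j')"
        proof (cases "(i, j') \<in> ?E")
          case True
          then have "(i, j) \<in> ?E" using c by (auto simp: skew_cell_iff)
          then show ?thesis
            using True c ssytD_row[of T nu mu i j j'] T by (simp add: tableaux_def)
        next
          case False
          then show ?thesis using c small[OF T, of "(i, j)"] by auto
        qed
      next
        fix i i' j assume c: "(i, j) \<in> ?D" "(i', j) \<in> ?D" "i < i'"
        then obtain k k' where k: "i = Suc k" "i' = Suc k'" "Suc k \<le> k'"
          by (auto simp: skew_cell_iff)
        have "row la k' \<le> row la (Suc k)" by (rule row_antimono[OF la k(3)])
        also have "\<dots> \<le> row nu k" using hs by (simp add: horizontal_strip_def)
        finally have E: "(i, j) \<in> ?E" using c by (auto simp: k)
        show "?ext T (i, j) < ?ext T (i', j)"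
        proof (cases "(i', j) \<in> ?E")
          case True
          then show ?thesis
            using E c ssytD_col[of T nu mu i j i'] T by (simp add: tableaux_def)
        next
          case False
          then show ?thesis using c E small[OF T E] by auto
        qed
      qed
      moreover have "small_entries_in n la mu (?ext T) nu"
        using small[OF T] by (auto simp: small_entries_in_def)
      ultimately show "?ext T \<in> ?L"
        using cont by (simp add: tableaux_def)
    qed
  qed
  then show ?thesis by (rule bij_betw_same_card)
qed

lemma small_entries_shape_unique:
  assumes "is_partition nu" "is_partition nu'" "mu \<subseteq>\<^sub>p nu" "mu \<subseteq>\<^sub>p nu'" "nu \<subseteq>\<^sub>p la" "nu' \<subseteq>\<^sub>p la"
    and "small_entries_in n la mu T nu" "small_entries_in n la mu T nu'"
  shows "nu = nu'"
proof -
  have eq: "skew_diagram nu mu = skew_diagram nu' mu"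
    using assms skew_diagram_mono[OF assms(5), of mu] skew_diagram_mono[OF assms(6), of mu]
    unfolding small_entries_in_def by blast
  have "row nu k = row nu' k" for k
  proof (rule ccontr)
    assume "row nu k \<noteq> row nu' k"
    moreover have "row mu k \<le> row nu k" "row mu k \<le> row nu' k"
      using assms(3,4) by (auto simp: contained_rows)
    moreover have "(Suc k, j) \<in> skew_diagram nu mu \<longleftrightarrow> (Suc k, j) \<in> skew_diagram nu' mu" for j
      by (simp only: eq)
    from this[of "row nu k"] this[of "row nu' k"]
    have "row mu k < row nu k \<longrightarrow> row nu k \<le> row nu' k" "row mu k < row nu' k \<longrightarrow> row nu' k \<le> row nu k"
      by auto
    ultimately show False by linarith
  qed
  then show ?thesis using assms(1,2) by (blast intro: partition_eqI)
qed

text \<open>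
  Rows increase weakly, so the entries below \<open>n\<close> form an initial segment of each row.  Columns increase
  strictly, so these segments shrink from row to row, and the entry above an \<open>n\<close> is below \<open>n\<close>, which
  makes the rest a horizontal strip.
\<close>

lemma small_entries_shape_exists:
  assumes la: "is_partition la" and mu: "is_partition mu" and sub: "mu \<subseteq>\<^sub>p la"
    and T: "T \<in> tableaux la mu (a + Poly_Mapping.single n d)" and a: "vars a \<subseteq> {..<n}"
  obtains nu where "is_partition nu" "mu \<subseteq>\<^sub>p nu" "horizontal_strip la nu"
    "sum_list la = sum_list nu + d" "small_entries_in n la mu T nu"
proof -
  let ?D = "skew_diagram la mu"
  have ssyt: "T \<in> ssyt la mu" and cont: "content la mu T = a + Poly_Mapping.single n d"
    using T by (auto simp: tableaux_def)
  \<comment> \<open>including \<open>row mu k\<close> gives a row without small entries the length it has in \<open>mu\<close>\<close>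
  define S where "S k = insert (row mu k) {j. (Suc k, j) \<in> ?D \<and> T (Suc k, j) < n}" for k
  define f where "f k = Max (S k)" for k
  have fin: "finite (S k)" for k
    unfolding S_def by (rule finite.insertI, rule finite_subset[of _ "{..row la k}"]) auto
  have f_ge: "row mu k \<le> f k" for k
    unfolding f_def by (rule Max_ge[OF fin]) (simp add: S_def)
  have f_le: "f k \<le> row la k" for k
    unfolding f_def using sub by (subst Max_le_iff[OF fin]) (auto simp: S_def contained_rows)
  have below: "T (Suc k, j) < n \<longleftrightarrow> j \<le> f k" if "(Suc k, j) \<in> ?D" for k j
  proof
    assume "T (Suc k, j) < n"
    then show "j \<le> f k"
      unfolding f_def using that by (intro Max_ge[OF fin]) (simp add: S_def)
  next
    assume j: "j \<le> f k"
    have "f k \<in> S k" unfolding f_def by (rule Max_in[OF fin]) (simp add: S_def)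
    then have fk: "(Suc k, f k) \<in> ?D" "T (Suc k, f k) < n"
      using j that by (auto simp: S_def)
    show "T (Suc k, j) < n"
    proof (cases "j = f k")
      case False
      then have "T (Suc k, j) \<le> T (Suc k, f k)"
        using j by (intro ssytD_row[OF ssyt that fk(1)]) simp
      then show ?thesis using fk(2) by simp
    qed (use fk in simp)
  qed
  have strip: "row la (Suc k) \<le> f k" for k
  proof (rule ccontr)
    assume "\<not> row la (Suc k) \<le> f k"
    then have less: "f k < row la (Suc k)" by simp
    have "row mu (Suc k) \<le> row mu k" "row la (Suc k) \<le> row la k"
      using row_antimono mu la by auto
    then have c: "(Suc k, row la (Suc k)) \<in> ?D" "(Suc (Suc k), row la (Suc k)) \<in> ?D"
      using less f_ge[of k] by auto
    have "T (Suc k, row la (Suc k)) < T (Suc (Suc k), row la (Suc k))"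
      by (rule ssytD_col[OF ssyt c]) simp
    also have "\<dots> \<le> n" by (rule entry_le_top[OF T a c(2)])
    finally show False using below[OF c(1)] less by simp
  qed
  have dec: "f (Suc k) \<le> f k" for k
    using f_le[of "Suc k"] strip[of k] by simp
  have zero: "f (length la) = 0"
    using f_le[of "length la"] by simp
  define nu where "nu = partition_of f"
  have nu: "is_partition nu" and row_nu: "row nu k = f k" for k
    using partition_of[of f, OF dec zero] by (auto simp: nu_def)
  have mu_nu: "mu \<subseteq>\<^sub>p nu" and hs: "horizontal_strip la nu"
    using f_ge f_le strip by (auto simp: contained_rows horizontal_strip_def row_nu)
  have small: "small_entries_in n la mu T nu"
    unfolding small_entries_in_def
  proof
    fix c assume c: "c \<in> ?D"
    obtain k j where kj: "c = (Suc k, j)"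
      using c by (cases c) (auto simp: skew_cell_iff)
    show "T c < n \<longleftrightarrow> c \<in> skew_diagram nu mu"
      using below[of k j] c unfolding kj by (auto simp: row_nu)
  qed
  have "content la mu T = content nu mu T + Poly_Mapping.single n (sum_list la - sum_list nu)"
  proof (rule content_split[OF mu_nu horizontal_strip_contained[OF hs] refl])
    fix c assume "c \<in> ?D - skew_diagram nu mu"
    then show "T c = n"
      using entry_le_top[OF T a, of c] small by (force simp: small_entries_in_def)
  qed
  moreover have "expo (content nu mu T) n = 0"
    unfolding content_def lookup_sum
    using small skew_diagram_mono[OF horizontal_strip_contained[OF hs], of mu]
    by (intro sum.neutral) (auto simp: small_entries_in_def lookup_single when_def)
  moreover have "expo a n = 0" using a by (metis in_keys_iff lessThan_iff less_irrefl subsetD)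
  ultimately have "d = sum_list la - sum_list nu"
    using cont by (metis add_0 lookup_add lookup_single_eq)
  then have "sum_list la = sum_list nu + d"
    using contained_size[OF horizontal_strip_contained[OF hs]] by simp
  then show thesis using that nu mu_nu hs small by blast
qed

text \<open>
  The entries of the matrix \<open>S\<close>, coefficient by coefficient.  For \<open>mu\<close> not contained in \<open>la\<close> the
  diagram loses its meaning but can still be filled, hence the explicit \<open>0\<close>.
\<close>

definition tableau_count :: "nat list \<Rightarrow> nat list \<Rightarrow> monomial \<Rightarrow> 'a::comm_ring_1" where
  "tableau_count la mu m = (if mu \<subseteq>\<^sub>p la then of_nat (card (tableaux la mu m)) else 0)"

lemma tableau_count_degree:
  "(tableau_count la mu m :: 'a::comm_ring_1) \<noteq> 0 \<Longrightarrow> sum_list la = sum_list mu + total_degree m"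
proof -
  assume nz: "(tableau_count la mu m :: 'a) \<noteq> 0"
  then have sub: "mu \<subseteq>\<^sub>p la" and "card (tableaux la mu m) \<noteq> 0"
    by (auto simp: tableau_count_def split: if_splits intro: ccontr)
  then have "tableaux la mu m \<noteq> {}" by force
  then have "total_degree m = sum_list la - sum_list mu"
    using total_degree_content[OF sub] by (auto simp: tableaux_def)
  then show ?thesis using contained_size[OF sub] by simp
qed

lemma tableau_count_top_variable:
  assumes la: "la \<in> partitions_le N" and mu: "is_partition mu" and a: "vars a \<subseteq> {..<n}"
  shows "tableau_count la mu (a + Poly_Mapping.single n d) =
    (\<Sum>nu\<in>partitions_le N. strip_of_size d la nu * (tableau_count nu mu a :: 'a::comm_ring_1))"
proof (cases "mu \<subseteq>\<^sub>p la")
  case False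
  then have "strip_of_size d la nu * (tableau_count nu mu a :: 'a) = 0" for nu
    using contained_trans[of mu nu la] horizontal_strip_contained[of la nu]
    by (auto simp: strip_of_size_def tableau_count_def)
  then show ?thesis using False by (simp add: tableau_count_def)
next
  case True
  have pla: "is_partition la" and sla: "sum_list la \<le> N" using la by (auto simp: partitions_le_def)
  let ?T = "tableaux la mu (a + Poly_Mapping.single n d)"
  define I where "I = {nu \<in> partitions_le N. mu \<subseteq>\<^sub>p nu \<and> horizontal_strip la nu \<and> sum_list la = sum_list nu + d}"
  let ?F = "\<lambda>nu. {T \<in> ?T. small_entries_in n la mu T nu}"
  have "?T = (\<Union>nu\<in>I. ?F nu)"
  proof (intro equalityI subsetI)
    fix T assume T: "T \<in> ?T"
    from small_entries_shape_exists[OF pla mu True T a] obtain nu where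
      "is_partition nu" "mu \<subseteq>\<^sub>p nu" "horizontal_strip la nu"
      "sum_list la = sum_list nu + d" "small_entries_in n la mu T nu" .
    then show "T \<in> (\<Union>nu\<in>I. ?F nu)"
      using T sla by (auto simp: I_def partitions_le_def)
  qed auto
  then have "card ?T = card (\<Union>nu\<in>I. ?F nu)" by simp
  also have "\<dots> = (\<Sum>nu\<in>I. card (?F nu))"
  proof (rule card_UN_disjoint)
    show "finite I" by (simp add: I_def)
    show "\<forall>nu\<in>I. finite (?F nu)"
      by (auto intro!: finite_subset[OF _ finite_ssyt_content] simp: tableaux_def)
    show "\<forall>nu\<in>I. \<forall>nu'\<in>I. nu \<noteq> nu' \<longrightarrow> ?F nu \<inter> ?F nu' = {}"
      using small_entries_shape_unique horizontal_strip_contained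
      by (fastforce simp: I_def partitions_le_def)
  qed
  also have "\<dots> = (\<Sum>nu\<in>I. card (tableaux nu mu a))"
    by (intro sum.cong refl card_tableaux_small_entries_in pla mu a) (auto simp: I_def partitions_le_def)
  finally have "(tableau_count la mu (a + Poly_Mapping.single n d) :: 'a) =
      (\<Sum>nu\<in>I. of_nat (card (tableaux nu mu a)))"
    using True by (simp add: tableau_count_def)
  also have "\<dots> = (\<Sum>nu\<in>partitions_le N. strip_of_size d la nu * tableau_count nu mu a)"
    by (rule sum.mono_neutral_cong_left) (auto simp: I_def strip_of_size_def tableau_count_def)
  finally show ?thesis .
qed

lemma tableau_count_zero:
  assumes "is_partition la" "is_partition mu"
  shows "tableau_count la mu 0 = of_bool (la = mu)"
proof (cases "mu \<subseteq>\<^sub>p la")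
  case True
  show ?thesis
  proof (cases "la = mu")
    case eq: True
    have D: "skew_diagram mu mu = {}" by (auto simp: skew_cell_iff)
    have "tableaux mu mu 0 = {\<lambda>_. undefined}"
      by (auto simp: tableaux_def ssyt_def content_def D)
    then show ?thesis using eq by (simp add: tableau_count_def)
  next
    case False
    then have "sum_list la \<noteq> sum_list mu + total_degree 0"
      using contained_same_size[OF assms True] by auto
    then have "tableau_count la mu 0 = (0 :: 'a)" using tableau_count_degree by blast
    then show ?thesis using False by simp
  qed
qed (auto simp: tableau_count_def)

section \<open>Moving ribbon weights through the variables\<close>

text \<open>
  The coefficients of the product of \<open>(1 - t * x) / (1 - s * x)\<close> over all variables \<open>x\<close>.
\<close>

definition monomial_weight :: "'a::comm_ring_1 \<Rightarrow> 'a \<Rightarrow> monomial \<Rightarrow> 'a" where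
  "monomial_weight s t m = (\<Prod>i\<in>vars m. exponent_weight s t (expo m i))"

lemma monomial_weight_plus_single:
  assumes "vars b \<subseteq> {..<n}"
  shows "monomial_weight s t (b + Poly_Mapping.single n e) = monomial_weight s t b * exponent_weight s t e"
proof -
  have all: "monomial_weight s t m = (\<Prod>i<k. exponent_weight s t (expo m i))" if "vars m \<subseteq> {..<k}" for m k
    unfolding monomial_weight_def using that
    by (intro prod.mono_neutral_left) (auto simp: in_keys_iff exponent_weight_def)
  have "vars (b + Poly_Mapping.single n e) \<subseteq> {..<Suc n}"
    using assms Poly_Mapping.keys_add[of b "Poly_Mapping.single n e"] by (fastforce split: if_splits)
  from all[OF this] have "monomial_weight s t (b + Poly_Mapping.single n e) =
      (\<Prod>i<n. exponent_weight s t (expo b i)) * exponent_weight s t (expo b n + e)"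
    by (simp add: lookup_add lookup_single when_def)
  also have "expo b n = 0" using assms by (metis in_keys_iff lessThan_iff less_irrefl subsetD)
  finally show ?thesis using all[OF assms] by simp
qed

lemma sum_splittings_top_variable:
  assumes m: "vars m \<subseteq> {..<n}"
  shows "(\<Sum>(a, b)\<in>splittings (m + Poly_Mapping.single n c). g a b) =
    (\<Sum>d\<le>c. \<Sum>(a, b)\<in>splittings m. g (a + Poly_Mapping.single n d) (b + Poly_Mapping.single n (c - d)))"
proof -
  let ?s = "Poly_Mapping.single n" and ?u = "Poly_Mapping.update n (0::nat)"
  have dec: "?u a + ?s (expo a n) = a" for a
    by (rule poly_mapping_eqI) (auto simp: lookup_add lookup_update lookup_single when_def)
  have upd: "?u (a + ?s d) = a" if "expo a n = 0" for a d
    using that by (intro poly_mapping_eqI) (auto simp: lookup_add lookup_update lookup_single when_def)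
  have m0: "expo m n = 0" using m by (metis in_keys_iff lessThan_iff less_irrefl subsetD)
  have "(\<Sum>d\<le>c. \<Sum>(a, b)\<in>splittings m. g (a + ?s d) (b + ?s (c - d))) =
      (\<Sum>(d, a, b)\<in>{..c} \<times> splittings m. g (a + ?s d) (b + ?s (c - d)))"
    by (subst sum.cartesian_product) (simp add: case_prod_unfold)
  also have "\<dots> = (\<Sum>(a, b)\<in>splittings (m + ?s c). g a b)"
  proof (rule sum.reindex_bij_witness[where
      i = "\<lambda>(a, b). (expo a n, ?u a, ?u b)" and j = "\<lambda>(d, a, b). (a + ?s d, b + ?s (c - d))"])
    fix x assume "x \<in> {..c} \<times> splittings m"
    then obtain d a b where x: "x = (d, a, b)" "d \<le> c" "a + b = m"
      by (auto simp: splittings_def)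
    have ab0: "expo a n = 0" "expo b n = 0"
      using m0 unfolding x(3)[symmetric] lookup_add by auto
    show "(case case x of (d, a, b) \<Rightarrow> (a + ?s d, b + ?s (c - d)) of (a, b) \<Rightarrow> (expo a n, ?u a, ?u b)) = x"
      using ab0 by (simp add: x(1) upd lookup_add)
    have "a + ?s d + (b + ?s (c - d)) = a + b + ?s (d + (c - d))"
      by (simp only: single_add ac_simps)
    then show "(case x of (d, a, b) \<Rightarrow> (a + ?s d, b + ?s (c - d))) \<in> splittings (m + ?s c)"
      using x by (simp add: splittings_def)
  next
    fix y assume "y \<in> splittings (m + ?s c)"
    then obtain a b where y: "y = (a, b)" "a + b = m + ?s c" by (auto simp: splittings_def)
    have n: "expo a n + expo b n = c"
      using arg_cong[OF y(2), of "\<lambda>f. expo f n"] m0 by (simp add: lookup_add)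
    then have "c - expo a n = expo b n" by simp
    then show "(case case y of (a, b) \<Rightarrow> (expo a n, ?u a, ?u b) of
        (d, a, b) \<Rightarrow> (a + ?s d, b + ?s (c - d))) = y"
      by (simp add: y(1) dec)
    have "?u a + ?u b = m"
    proof (rule poly_mapping_eqI)
      fix i
      show "expo (?u a + ?u b) i = expo m i"
        using arg_cong[OF y(2), of "\<lambda>f. expo f i"] m0
        by (auto simp: lookup_add lookup_update lookup_single when_def split: if_splits)
    qed
    then show "(case y of (a, b) \<Rightarrow> (expo a n, ?u a, ?u b)) \<in> {..c} \<times> splittings m"
      using n by (auto simp: y(1) splittings_def)
  qed auto
  finally show ?thesis ..
qed

text \<open>
  This is the identity \<open>R\<^sub>s\<^sub>,\<^sub>t^T S R\<^sub>t\<^sub>,\<^sub>s^T = F S\<close> at a monomial \<open>m\<close>, where \<open>F\<close> is the product of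
  \<open>(1 - t * x) / (1 - s * x)\<close> over all variables.  The induction on the number of variables strips off
  the factor of the last one, for which \<open>ribbon_weight_commute\<close> applies; without variables, only
  the product of the two mutually inverse ribbon matrices is left.
\<close>

lemma tableau_count_times_monomial_weight:
  fixes s t :: "'a::comm_ring_1"
  assumes "vars m \<subseteq> {..<n}" "is_partition mu" "la \<in> partitions_le N" "sum_list mu + total_degree m \<le> N"
  shows "(\<Sum>(a, b)\<in>splittings m. tableau_count la mu a * monomial_weight s t b) =
    (\<Sum>lp\<in>partitions_le N. \<Sum>mm\<in>partitions_le N.
       ribbon_weight s t lp la * (ribbon_weight t s mu mm * tableau_count lp mm m))"
  using assms(1,3,4)
proof (induction n arbitrary: m la)
  case 0
  then have m: "m = 0" by auto
  let ?P = "partitions_le N"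
  have pla: "is_partition la" using 0 by (simp add: partitions_le_def)
  have "splittings (0 :: monomial) = {(0, 0)}"
  proof -
    have z: "a = 0 \<and> b = 0" if "a + b = (0 :: monomial)" for a b
    proof -
      have "expo a i = 0 \<and> expo b i = 0" for i
        using arg_cong[OF that, of "\<lambda>f. expo f i"] by (simp add: lookup_add)
      then show ?thesis by (auto intro: poly_mapping_eqI)
    qed
    show ?thesis by (auto simp: splittings_def dest: z)
  qed
  then have "(\<Sum>(a, b)\<in>splittings m. tableau_count la mu a * monomial_weight s t b) = of_bool (mu = la)"
    using pla assms(2) by (auto simp: m tableau_count_zero monomial_weight_def)
  also have "\<dots> = (\<Sum>lp\<in>?P. ribbon_weight t s mu lp * ribbon_weight s t lp la)"
    using 0 assms(2) by (subst ribbon_weight_inverse) (auto simp: partitions_le_def)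
  also have "\<dots> = (\<Sum>lp\<in>?P. \<Sum>mm\<in>?P. if mm = lp then ribbon_weight t s mu lp * ribbon_weight s t lp la else 0)"
    by (intro sum.cong refl) simp
  also have "\<dots> = (\<Sum>lp\<in>?P. \<Sum>mm\<in>?P.
      ribbon_weight s t lp la * (ribbon_weight t s mu mm * tableau_count lp mm m))"
    by (intro sum.cong refl) (auto simp: m tableau_count_zero partitions_le_def mult.commute)
  finally show ?case .
next
  case (Suc n)
  let ?P = "partitions_le N" and ?s = "Poly_Mapping.single n"
  let ?R = "ribbon_weight s t" and ?R' = "ribbon_weight t s"
  let ?w = "exponent_weight s t" and ?W = "monomial_weight s t"
  define c where "c = expo m n"
  define m' where "m' = Poly_Mapping.update n 0 m"
  have m: "m = m' + ?s c"
    by (rule poly_mapping_eqI) (auto simp: m'_def c_def lookup_add lookup_update lookup_single when_def)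
  have "expo m' i = 0" if "n \<le> i" for i
  proof (cases "i = n")
    case False
    then have "i \<notin> vars m" using Suc.prems(1) that by auto
    then show ?thesis using False by (simp add: m'_def lookup_update in_keys_iff)
  qed (simp add: m'_def lookup_update)
  then have m': "vars m' \<subseteq> {..<n}"
    by (metis in_keys_iff lessThan_iff not_le subsetI)
  have deg: "sum_list mu + total_degree m' + c \<le> N"
    using Suc.prems(3) by (simp add: m)
  \<comment> \<open>\<open>N\<close> bounds the size of \<open>nu\<close> as needed for \<open>ribbon_weight_commute\<close> whenever the other factors do not vanish\<close>
  have commute: "?R' mu mm * (tableau_count nu mm m' * (\<Sum>lp\<in>?P. ?R lp la * strip_of_size c lp nu)) =
      ?R' mu mm * (tableau_count nu mm m' *
        (\<Sum>d\<le>c. ?w (c - d) * (\<Sum>rh\<in>?P. strip_of_size d la rh * ?R nu rh)))"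
    if "nu \<in> ?P" for mm nu
  proof (cases "?R' mu mm = 0 \<or> (tableau_count nu mm m' :: 'a) = 0")
    case False
    then have "mm \<subseteq>\<^sub>p mu" "(tableau_count nu mm m' :: 'a) \<noteq> 0"
      by (auto simp: ribbon_weight_def split: if_splits)
    then have "sum_list nu + c \<le> N"
      using deg contained_size[of mm mu] tableau_count_degree[of nu mm m'] by fastforce
    then show ?thesis
      using ribbon_weight_commute[of nu c N la s t] that Suc.prems(2) by (simp add: partitions_le_def)
  qed auto
  have "(\<Sum>lp\<in>?P. \<Sum>mm\<in>?P. ?R lp la * (?R' mu mm * tableau_count lp mm m)) =
      (\<Sum>lp\<in>?P. \<Sum>mm\<in>?P. \<Sum>nu\<in>?P.
         ?R' mu mm * (tableau_count nu mm m' * (?R lp la * strip_of_size c lp nu)))"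
    unfolding m
    by (intro sum.cong refl, subst tableau_count_top_variable[OF _ _ m'])
      (auto simp: partitions_leD sum_distrib_left algebra_simps)
  also have "\<dots> = (\<Sum>mm\<in>?P. \<Sum>nu\<in>?P.
      ?R' mu mm * (tableau_count nu mm m' * (\<Sum>lp\<in>?P. ?R lp la * strip_of_size c lp nu)))"
    by (subst sum_swap_inner) (simp add: sum_distrib_left)
  also have "\<dots> = (\<Sum>mm\<in>?P. \<Sum>nu\<in>?P. ?R' mu mm * (tableau_count nu mm m' *
        (\<Sum>d\<le>c. ?w (c - d) * (\<Sum>rh\<in>?P. strip_of_size d la rh * ?R nu rh))))"
    by (intro sum.cong refl commute)
  also have "\<dots> = (\<Sum>mm\<in>?P. \<Sum>nu\<in>?P. \<Sum>d\<le>c. \<Sum>rh\<in>?P.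
      ?w (c - d) * (strip_of_size d la rh * (?R nu rh * (?R' mu mm * tableau_count nu mm m'))))"
    by (simp add: sum_distrib_left algebra_simps)
  also have "\<dots> = (\<Sum>nu\<in>?P. \<Sum>mm\<in>?P. \<Sum>d\<le>c. \<Sum>rh\<in>?P.
      ?w (c - d) * (strip_of_size d la rh * (?R nu rh * (?R' mu mm * tableau_count nu mm m'))))"
    by (rule sum.swap)
  also have "\<dots> = (\<Sum>nu\<in>?P. \<Sum>d\<le>c. \<Sum>rh\<in>?P. \<Sum>mm\<in>?P.
      ?w (c - d) * (strip_of_size d la rh * (?R nu rh * (?R' mu mm * tableau_count nu mm m'))))"
    by (intro sum.cong refl sum_swap_inner)
  also have "\<dots> = (\<Sum>d\<le>c. \<Sum>rh\<in>?P. ?w (c - d) * (strip_of_size d la rh *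
      (\<Sum>nu\<in>?P. \<Sum>mm\<in>?P. ?R nu rh * (?R' mu mm * tableau_count nu mm m'))))"
    by (subst sum_swap_inner) (simp add: sum_distrib_left)
  also have "\<dots> = (\<Sum>d\<le>c. \<Sum>rh\<in>?P. ?w (c - d) * (strip_of_size d la rh *
      (\<Sum>(a, b)\<in>splittings m'. tableau_count rh mu a * ?W b)))"
    using deg by (intro sum.cong refl, subst Suc.IH[OF m']) auto
  also have "\<dots> = (\<Sum>d\<le>c. \<Sum>rh\<in>?P. \<Sum>p\<in>splittings m'.
      (strip_of_size d la rh * tableau_count rh mu (fst p)) * (?W (snd p) * ?w (c - d)))"
    by (simp add: sum_distrib_left case_prod_unfold algebra_simps)
  also have "\<dots> = (\<Sum>d\<le>c. \<Sum>p\<in>splittings m'.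
      (\<Sum>rh\<in>?P. strip_of_size d la rh * tableau_count rh mu (fst p)) * (?W (snd p) * ?w (c - d)))"
    by (intro sum.cong refl, subst sum.swap) (simp add: sum_distrib_right)
  also have "\<dots> = (\<Sum>d\<le>c. \<Sum>p\<in>splittings m'.
      tableau_count la mu (fst p + ?s d) * ?W (snd p + ?s (c - d)))"
  proof (intro sum.cong refl)
    fix d p assume "p \<in> splittings m'"
    then have "fst p + snd p = m'" by (auto simp: splittings_def)
    then have "vars (fst p) \<subseteq> vars m'" "vars (snd p) \<subseteq> vars m'"
      by (auto simp: in_keys_iff lookup_add)
    with m' have "vars (fst p) \<subseteq> {..<n}" "vars (snd p) \<subseteq> {..<n}" by auto
    then show "(\<Sum>rh\<in>?P. strip_of_size d la rh * tableau_count rh mu (fst p)) * (?W (snd p) * ?w (c - d)) =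
        tableau_count la mu (fst p + ?s d) * ?W (snd p + ?s (c - d))"
      using tableau_count_top_variable[OF Suc.prems(2) assms(2), of "fst p" n d, where 'a = 'a]
      by (simp add: monomial_weight_plus_single)
  qed
  also have "\<dots> = (\<Sum>(a, b)\<in>splittings m. tableau_count la mu a * ?W b)"
    unfolding m sum_splittings_top_variable[OF m'] by (simp add: case_prod_unfold)
  finally show ?case ..
qed

section \<open>Components of a broken ribbon\<close>

lemma same_component_equiv:
  "equiv D (Restr ((Restr adjacent D)\<^sup>*) D)"
proof (rule equivI)
  have "sym (Restr adjacent D)" by (auto simp: sym_def adjacent_def)
  then have "sym ((Restr adjacent D)\<^sup>*)" by (rule sym_rtrancl)
  then show "sym (Restr ((Restr adjacent D)\<^sup>*) D)" by (auto simp: sym_def)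
  show "trans (Restr ((Restr adjacent D)\<^sup>*) D)"
    by (auto intro!: transI intro: rtrancl_trans)
qed (auto simp: refl_on_def)

text \<open>
  If each fibre of \<open>f\<close> on \<open>D\<close> stays inside one component, the images of different components are disjoint.
  With \<open>f\<close> the projection to rows or columns, this relates height or width and the number of
  components to the number of non-empty rows or columns.
\<close>

lemma sum_card_image_components:
  assumes fin: "finite D"
    and f: "\<And>c c'. c \<in> D \<Longrightarrow> c' \<in> D \<Longrightarrow> f c = f c' \<Longrightarrow> (c, c') \<in> (Restr adjacent D)\<^sup>*"
  shows "(\<Sum>C\<in>components D. card (f ` C) - 1) + card (components D) = card (f ` D)"
proof -
  let ?E = "Restr ((Restr adjacent D)\<^sup>*) D"
  have eq: "equiv D ?E" by (rule same_component_equiv)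
  have sub: "C \<subseteq> D" if "C \<in> components D" for C
    using that eq in_quotient_imp_subset unfolding components_def by blast
  have finC: "finite (components D)"
    unfolding components_def by (rule finite_quotient[OF fin]) auto
  have pos: "card (f ` C) \<ge> 1" if "C \<in> components D" for C
    using that eq in_quotient_imp_non_empty[of D ?E C] finite_subset[OF sub[OF that] fin]
    by (simp add: components_def Suc_le_eq card_gt_0_iff)
  have "card (f ` D) = card (\<Union>C\<in>components D. f ` C)"
    using Union_quotient[OF eq] unfolding components_def by (metis image_Union)
  also have "\<dots> = (\<Sum>C\<in>components D. card (f ` C))"
  proof (rule card_UN_disjoint[OF finC])
    show "\<forall>C\<in>components D. finite (f ` C)"
      using sub finite_subset[OF _ fin] by blast
    show "\<forall>C\<in>components D. \<forall>C'\<in>components D. C \<noteq> C' \<longrightarrow> f ` C \<inter> f ` C' = {}"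
    proof (intro ballI impI)
      fix C C' assume C: "C \<in> components D" "C' \<in> components D" "C \<noteq> C'"
      show "f ` C \<inter> f ` C' = {}"
      proof (rule ccontr)
        assume "f ` C \<inter> f ` C' \<noteq> {}"
        then obtain c c' where c: "c \<in> C" "c' \<in> C'" "f c = f c'" by blast
        then have "c \<in> D" "c' \<in> D" using sub C by blast+
        then have "(c, c') \<in> ?E" using f c(3) by blast
        then have "C = C'"
          using quotient_eqI[OF eq] C c unfolding components_def by blast
        with C(3) show False ..
      qed
    qed
  qed
  also have "\<dots> = (\<Sum>C\<in>components D. (card (f ` C) - 1) + 1)"
    using pos by (intro sum.cong refl) (metis le_add_diff_inverse2)
  finally show ?thesis by (simp only: sum.distrib) simp
qed

definition nonempty_rows :: "nat list \<Rightarrow> nat list \<Rightarrow> nat set" where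
  "nonempty_rows la mu = {k. row mu k < row la k}"

text \<open>
  The rows that share a column with the next row: the cell of row \<open>k\<close> in column \<open>row la (k + 1)\<close> is
  then present and has a neighbour below.
\<close>

definition overlap_rows :: "nat list \<Rightarrow> nat list \<Rightarrow> nat set" where
  "overlap_rows la mu = {k. row mu k < row la (Suc k)}"

lemma nonempty_rows_subset: "nonempty_rows la mu \<subseteq> {..<length la}"
  by (auto simp: nonempty_rows_def row_nth split: if_splits)

lemma finite_nonempty_rows [simp]: "finite (nonempty_rows la mu)"
  by (rule finite_subset[OF nonempty_rows_subset]) simp

lemma overlap_rows_subset: "is_partition la \<Longrightarrow> overlap_rows la mu \<subseteq> nonempty_rows la mu"
  using row_antimono[of la k "Suc k" for k]
  by (auto simp: overlap_rows_def nonempty_rows_def intro: less_le_trans)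

lemma row_connected:
  assumes c: "(i, j) \<in> skew_diagram la mu" "(i, j') \<in> skew_diagram la mu"
  shows "((i, j), (i, j')) \<in> (Restr adjacent (skew_diagram la mu))\<^sup>*"
proof -
  let ?A = "Restr adjacent (skew_diagram la mu)"
  have sym: "sym (?A\<^sup>*)"
    by (rule sym_rtrancl) (auto simp: sym_def adjacent_def)
  have up: "((i, j), (i, j')) \<in> ?A\<^sup>*" if "j \<le> j'" "(i, j) \<in> skew_diagram la mu" "(i, j') \<in> skew_diagram la mu" for j j'
    using that(1,3)
  proof (induction rule: dec_induct)
    case (step l)
    then have "(i, l) \<in> skew_diagram la mu"
      using that(2) by (auto simp: skew_cell_iff)
    with step have "((i, j), (i, l)) \<in> ?A\<^sup>*" "((i, l), (i, Suc l)) \<in> ?A"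
      by (auto simp: adjacent_def)
    then show ?case by (rule rtrancl_into_rtrancl)
  qed simp
  show ?thesis
    using up[of j j'] up[of j' j] c symD[OF sym] by (meson linear)
qed

lemma column_convex:
  assumes "is_partition la" "is_partition mu"
    and "(i, j) \<in> skew_diagram la mu" "(i', j) \<in> skew_diagram la mu" "i \<le> l" "l \<le> i'"
  shows "(l, j) \<in> skew_diagram la mu"
proof -
  obtain k k' where k: "i = Suc k" "i' = Suc k'" using assms(3,4) by (auto simp: skew_cell_iff)
  then obtain m where m: "l = Suc m" "k \<le> m" "m \<le> k'" using assms(5,6) by (cases l) auto
  show ?thesis
    using row_antimono[OF assms(2) m(2)] row_antimono[OF assms(1) m(3)] assms(3,4) by (simp add: k m)
qed

lemma column_connected:
  assumes la: "is_partition la" and mu: "is_partition mu"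
    and c: "(i, j) \<in> skew_diagram la mu" "(i', j) \<in> skew_diagram la mu"
  shows "((i, j), (i', j)) \<in> (Restr adjacent (skew_diagram la mu))\<^sup>*"
proof -
  let ?A = "Restr adjacent (skew_diagram la mu)"
  have sym: "sym (?A\<^sup>*)"
    by (rule sym_rtrancl) (auto simp: sym_def adjacent_def)
  have up: "((i, j), (i', j)) \<in> ?A\<^sup>*" if "i \<le> i'" "(i, j) \<in> skew_diagram la mu" "(i', j) \<in> skew_diagram la mu" for i i'
    using that(1,3)
  proof (induction rule: dec_induct)
    case (step l)
    then have "(l, j) \<in> skew_diagram la mu"
      using column_convex[OF la mu that(2) step.prems, of l] by simp
    with step have "((i, j), (l, j)) \<in> ?A\<^sup>*" "((l, j), (Suc l, j)) \<in> ?A"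
      by (auto simp: adjacent_def)
    then show ?case by (rule rtrancl_into_rtrancl)
  qed simp
  show ?thesis
    using up[of i i'] up[of i' i] c symD[OF sym] by (meson linear)
qed

lemma rows_of_skew_diagram: "fst ` skew_diagram la mu = Suc ` nonempty_rows la mu"
proof -
  have "Suc k \<in> fst ` skew_diagram la mu" if "row mu k < row la k" for k
    using that by (intro image_eqI[of _ _ "(Suc k, row la k)"]) auto
  then show ?thesis by (auto simp: skew_cell_iff nonempty_rows_def)
qed

text \<open>
  A component is determined by its last row.  A non-empty row is the last row of its component exactly
  if it does not overlap with the next row, because paths move by at most one row at a time.
\<close>

lemma rib_eq:
  assumes la: "is_partition la" and mu: "is_partition mu"
  shows "rib la mu = card (nonempty_rows la mu) - card (overlap_rows la mu)"
proof -
  let ?D = "skew_diagram la mu"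
  let ?A = "Restr adjacent ?D" and ?E = "Restr ((Restr adjacent ?D)\<^sup>*) ?D"
  let ?last = "\<lambda>C. Max (fst ` C)"
  have eq: "equiv ?D ?E" by (rule same_component_equiv)
  have sub: "C \<subseteq> ?D" if "C \<in> components ?D" for C
    using that eq in_quotient_imp_subset unfolding components_def by blast
  have fin: "finite (fst ` C)" if "C \<in> components ?D" for C
    using sub[OF that] finite_subset[OF _ finite_skew_diagram] by blast
  have closed: "c' \<in> C" if "C \<in> components ?D" "c \<in> C" "(c, c') \<in> ?A\<^sup>*" "c' \<in> ?D" for C c c'
  proof -
    have "(c, c') \<in> ?E" using that sub by blast
    then show ?thesis
      using in_quotient_imp_closed[OF eq, of C c c'] that unfolding components_def by blast
  qed
  have last: "\<exists>k j. ?last C = Suc k \<and> (Suc k, j) \<in> C" if C: "C \<in> components ?D" for C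
  proof -
    have "C \<noteq> {}" using in_quotient_imp_non_empty[OF eq] C unfolding components_def by blast
    then have "?last C \<in> fst ` C" using fin[OF C] by (intro Max_in) auto
    then obtain j where j: "(?last C, j) \<in> C" by force
    then have "(?last C, j) \<in> ?D" using sub[OF C] by blast
    then obtain k where "?last C = Suc k" unfolding skew_cell_iff by blast
    then show ?thesis using j by auto
  qed
  have "inj_on ?last (components ?D)"
  proof (rule inj_onI)
    fix C C' assume C: "C \<in> components ?D" "C' \<in> components ?D" "?last C = ?last C'"
    obtain k j where j: "?last C = Suc k" "(Suc k, j) \<in> C" using last[OF C(1)] by blast
    obtain j' where j': "(Suc k, j') \<in> C'" using last[OF C(2)] C(3) j by auto
    have "((Suc k, j), (Suc k, j')) \<in> ?E"
      using row_connected[of "Suc k" j la mu j'] j j' sub C by blast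
    then show "C = C'"
      using quotient_eqI[OF eq _ _ j(2) j'] C unfolding components_def by blast
  qed
  moreover have "?last ` components ?D = Suc ` (nonempty_rows la mu - overlap_rows la mu)"
  proof (intro equalityI subsetI)
    fix r assume "r \<in> ?last ` components ?D"
    then obtain C where C: "C \<in> components ?D" "r = ?last C" by blast
    obtain k j where k: "?last C = Suc k" "(Suc k, j) \<in> C" using last[OF C(1)] by blast
    then have cD: "(Suc k, j) \<in> ?D" using sub[OF C(1)] by blast
    have "k \<notin> overlap_rows la mu"
    proof
      assume ov: "k \<in> overlap_rows la mu"
      let ?j = "row la (Suc k)"
      have "row la (Suc k) \<le> row la k" "row mu (Suc k) \<le> row mu k"
        using row_antimono la mu by auto
      then have cells: "(Suc k, ?j) \<in> ?D" "(Suc (Suc k), ?j) \<in> ?D"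
        using ov by (auto simp: overlap_rows_def)
      then have "((Suc k, ?j), (Suc (Suc k), ?j)) \<in> ?A" by (auto simp: adjacent_def)
      then have "((Suc k, j), (Suc (Suc k), ?j)) \<in> ?A\<^sup>*"
        using row_connected[OF cD cells(1)] by (rule rtrancl_into_rtrancl[rotated])
      then have "(Suc (Suc k), ?j) \<in> C" by (rule closed[OF C(1) k(2) _ cells(2)])
      then have "Suc (Suc k) \<le> ?last C" using fin[OF C(1)] by (intro Max_ge) force+
      then show False using k by simp
    qed
    then show "r \<in> Suc ` (nonempty_rows la mu - overlap_rows la mu)"
      using C k cD by (auto simp: nonempty_rows_def)
  next
    fix r assume "r \<in> Suc ` (nonempty_rows la mu - overlap_rows la mu)"
    then obtain k where "r = Suc k" "k \<in> nonempty_rows la mu" "k \<notin> overlap_rows la mu"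
      by blast
    then have k: "r = Suc k" "row mu k < row la k" "row la (Suc k) \<le> row mu k"
      by (simp_all add: nonempty_rows_def overlap_rows_def)
    let ?c = "(Suc k, row la k)"
    have c: "?c \<in> ?D" using k by simp
    let ?C = "?E `` {?c}"
    have C: "?C \<in> components ?D" unfolding components_def using c by (rule quotientI)
    have below: "fst x \<le> Suc k" if "(?c, x) \<in> ?A\<^sup>*" for x
      using that
    proof (induction rule: rtrancl_induct)
      case (step x y)
      then obtain l j l' j' where xy: "x = (Suc l, j)" "y = (Suc l', j')"
        by (cases x; cases y) (auto simp: skew_cell_iff)
      have "\<not> (l = k \<and> l' = Suc k \<and> j' = j)"
        using step.hyps(2) k unfolding xy by auto
      then show ?case
        using step.hyps(2) step.IH unfolding xy by (auto simp: adjacent_def)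
    qed simp
    have "?last ?C = r"
    proof (rule Max_eqI[OF fin[OF C]])
      show "y \<le> r" if "y \<in> fst ` ?C" for y
        using that below k(1) by auto
      show "r \<in> fst ` ?C"
        using c k(1) by (intro image_eqI[of _ _ ?c]) auto
    qed
    then show "r \<in> ?last ` components ?D" using C by blast
  qed
  ultimately have "rib la mu = card (nonempty_rows la mu - overlap_rows la mu)"
    unfolding rib_def by (metis card_image inj_Suc inj_on_subset subset_UNIV)
  then show ?thesis
    using overlap_rows_subset[OF la, of mu] finite_subset[OF _ finite_nonempty_rows]
    by (simp add: card_Diff_subset)
qed

text \<open>
  A two by two block in rows \<open>k\<close> and \<open>k + 1\<close> is the same as two common columns of these rows, the first
  of which may be taken to be the first column of row \<open>k\<close>.
\<close>

lemma broken_ribbon_iff: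
  assumes la: "is_partition la" and mu: "is_partition mu"
  shows "broken_ribbon la mu \<longleftrightarrow> (\<forall>k. row la (Suc k) \<le> Suc (row mu k))"
proof
  assume br: "broken_ribbon la mu"
  show "\<forall>k. row la (Suc k) \<le> Suc (row mu k)"
  proof (rule ccontr)
    assume "\<not> ?thesis"
    then obtain k where k: "Suc (row mu k) < row la (Suc k)" by (auto simp: not_le)
    have "row la (Suc k) \<le> row la k" "row mu (Suc k) \<le> row mu k"
      using row_antimono la mu by auto
    with k have "{(Suc k, Suc (row mu k)), (Suc k, Suc (row mu k) + 1),
        (Suc k + 1, Suc (row mu k)), (Suc k + 1, Suc (row mu k) + 1)} \<subseteq> skew_diagram la mu"
      by simp
    with br show False unfolding broken_ribbon_def has_square_def by blast
  qed
next
  assume le: "\<forall>k. row la (Suc k) \<le> Suc (row mu k)"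
  have False if "{(i, j), (i, j + 1), (i + 1, j), (i + 1, j + 1)} \<subseteq> skew_diagram la mu" for i j
  proof -
    have "(i, j) \<in> skew_diagram la mu" using that by blast
    then obtain k where "i = Suc k" unfolding skew_cell_iff by blast
    with that le[rule_format, of k] show False by simp
  qed
  then show "broken_ribbon la mu" unfolding broken_ribbon_def has_square_def by blast
qed

text \<open>
  Each column has one lowest cell.  The other cells are those with a neighbour below, and without two
  by two blocks there is exactly one of them for each overlap.
\<close>

lemma card_columns_broken_ribbon:
  assumes la: "is_partition la" and mu: "is_partition mu" and sub: "mu \<subseteq>\<^sub>p la"
    and br: "broken_ribbon la mu"
  shows "card (snd ` skew_diagram la mu) + card (overlap_rows la mu) = sum_list la - sum_list mu"
proof -
  let ?D = "skew_diagram la mu"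
  have le: "row la (Suc k) \<le> Suc (row mu k)" for k
    using br by (simp add: broken_ribbon_iff[OF la mu])
  define L where "L = (\<lambda>k. (Suc k, Suc (row mu k))) ` overlap_rows la mu"
  have L: "(i, j) \<in> L \<longleftrightarrow> (i, j) \<in> ?D \<and> (Suc i, j) \<in> ?D" for i j
  proof (cases i)
    case 0
    then show ?thesis by (auto simp: L_def skew_cell_iff)
  next
    case (Suc k)
    have "row la (Suc k) \<le> row la k" "row mu (Suc k) \<le> row mu k"
      using row_antimono la mu by auto
    then have "(Suc k, j) \<in> ?D \<and> (Suc (Suc k), j) \<in> ?D \<longleftrightarrow> j = Suc (row mu k) \<and> row mu k < row la (Suc k)"
      using le[of k] by (simp; linarith)
    then show ?thesis by (auto simp: L_def Suc overlap_rows_def)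
  qed
  have "inj_on snd (?D - L)"
  proof (rule inj_onI, clarsimp)
    fix i i' j assume c: "(i, j) \<in> ?D" "(i, j) \<notin> L" "(i', j) \<in> ?D" "(i', j) \<notin> L"
    have no: "\<not> i < i'" if "(i, j) \<in> ?D" "(i, j) \<notin> L" "(i', j) \<in> ?D" for i i'
    proof
      assume "i < i'"
      then have "(Suc i, j) \<in> ?D" using column_convex[OF la mu that(1,3), of "Suc i"] by simp
      then show False using that L by blast
    qed
    show "i = i'" using no[of i i'] no[of i' i] c by simp
  qed
  moreover have "snd ` (?D - L) = snd ` ?D"
  proof (intro equalityI subsetI)
    fix j assume "j \<in> snd ` ?D"
    then obtain i where i: "(i, j) \<in> ?D" by force
    let ?S = "{i. (i, j) \<in> ?D}"
    have fin: "finite ?S"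
      by (rule finite_subset[of _ "fst ` ?D"]) (force simp: finite_skew_diagram)+
    have "Max ?S \<in> ?S" using fin i by (intro Max_in) auto
    moreover have "Suc (Max ?S) \<notin> ?S" using Max_ge[OF fin] by fastforce
    ultimately have "(Max ?S, j) \<in> ?D - L" using L by blast
    then show "j \<in> snd ` (?D - L)" by force
  qed auto
  ultimately have "card (snd ` ?D) = card (?D - L)" using card_image by fastforce
  also have "\<dots> = card ?D - card L"
    using L by (intro card_Diff_subset finite_subset[OF _ finite_skew_diagram[of la mu]]) auto
  finally have "card (snd ` ?D) = card ?D - card L" .
  moreover have "card L \<le> card ?D"
    using L by (intro card_mono finite_skew_diagram) auto
  moreover have "card L = card (overlap_rows la mu)"
    unfolding L_def by (rule card_image) (simp add: inj_on_def)
  ultimately show ?thesis using card_skew_diagram[OF sub] by simp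
qed

lemma broken_ribbon_statistics:
  assumes la: "is_partition la" and mu: "is_partition mu" and sub: "mu \<subseteq>\<^sub>p la"
    and br: "broken_ribbon la mu"
  shows "ht la mu = card (overlap_rows la mu)"
    and "rib la mu + card (overlap_rows la mu) = card (nonempty_rows la mu)"
    and "wt la mu + card (nonempty_rows la mu) = sum_list la - sum_list mu"
proof -
  let ?D = "skew_diagram la mu"
  have le: "card (overlap_rows la mu) \<le> card (nonempty_rows la mu)"
    by (rule card_mono[OF finite_nonempty_rows overlap_rows_subset[OF la]])
  then show rib: "rib la mu + card (overlap_rows la mu) = card (nonempty_rows la mu)"
    using rib_eq[OF la mu] by simp
  have "ht la mu + rib la mu = card (fst ` ?D)"
    unfolding ht_def rib_def
    by (rule sum_card_image_components[OF finite_skew_diagram]) (auto intro: row_connected)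
  also have "\<dots> = card (nonempty_rows la mu)"
    unfolding rows_of_skew_diagram by (simp add: card_image)
  finally show "ht la mu = card (overlap_rows la mu)" using rib by simp
  have "wt la mu + rib la mu = card (snd ` ?D)"
    unfolding wt_def rib_def
    by (rule sum_card_image_components[OF finite_skew_diagram]) (auto intro: column_connected[OF la mu])
  then show "wt la mu + card (nonempty_rows la mu) = sum_list la - sum_list mu"
    using card_columns_broken_ribbon[OF la mu sub br] rib by simp
qed

text \<open>
  Each overlap contributes \<open>-t\<close>, each last row of a component \<open>s - t\<close>, and a non-empty row contributes
  one \<open>s\<close> for every cell but one.  The width has the same total, because the number of non-empty rows is
  \<open>ht + rib\<close> and the number of cells is \<open>ht + rib + wt\<close>.
\<close>

lemma ribbon_weight_eq:
  fixes s t :: "'a::comm_ring_1"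
  assumes la: "is_partition la" and mu: "is_partition mu" and sub: "mu \<subseteq>\<^sub>p la"
  shows "ribbon_weight s t la mu = (if broken_ribbon la mu
    then (- t) ^ ht la mu * (s - t) ^ rib la mu * s ^ wt la mu else 0)"
proof (cases "broken_ribbon la mu")
  case False
  then obtain k where k: "Suc (row mu k) < row la (Suc k)"
    unfolding broken_ribbon_iff[OF la mu] by (auto simp: not_le)
  then have "Suc k < length la" using row_pos_iff[OF la, of "Suc k"] by simp
  moreover have "row_factor s t (row mu k) (row la k) (row la (Suc k)) = 0"
    using k by (simp add: row_factor_def)
  ultimately have "(\<Prod>i<length la. row_factor s t (row mu i) (row la i) (row la (Suc i))) = 0"
    by (intro prod_zero bexI[of _ k]) auto
  then show ?thesis using False by (simp add: ribbon_weight_def)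
next
  case True
  let ?O = "overlap_rows la mu" and ?N = "nonempty_rows la mu"
  let ?I = "{..<length la}"
  have ON: "?O \<subseteq> ?N" and NI: "?N \<subseteq> ?I"
    using overlap_rows_subset[OF la] nonempty_rows_subset by auto
  have power_card: "(\<Prod>i\<in>?I. if i \<in> S then c else 1) = c ^ card S" if "S \<subseteq> ?I" for S and c :: 'a
    using that by (simp add: prod.If_cases Int_absorb1)
  have factor: "row_factor s t (row mu i) (row la i) (row la (Suc i)) =
      (if i \<in> ?O then - t else 1) * (if i \<in> ?N - ?O then s - t else 1) * s ^ (row la i - row mu i - 1)" for i
  proof -
    have "row la (Suc i) \<le> Suc (row mu i)" "row la (Suc i) \<le> row la i" "row mu i \<le> row la i"
      using True sub row_antimono[OF la, of i "Suc i"]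
      by (auto simp: broken_ribbon_iff[OF la mu] contained_rows)
    then show ?thesis
      by (auto simp: row_factor_def overlap_rows_def nonempty_rows_def)
  qed
  have "(\<Sum>i\<in>?I. row la i - row mu i - 1) + card ?N = sum_list la - sum_list mu"
  proof -
    have "card ?N = (\<Sum>i\<in>?I. of_bool (i \<in> ?N))"
      using NI by (simp add: sum.If_cases of_bool_def Int_absorb1)
    then have "(\<Sum>i\<in>?I. row la i - row mu i - 1) + card ?N =
        (\<Sum>i\<in>?I. row la i - row mu i - 1 + of_bool (i \<in> ?N))"
      by (simp only: sum.distrib)
    also have "\<dots> = (\<Sum>i\<in>?I. row la i - row mu i)"
      by (intro sum.cong) (auto simp: nonempty_rows_def)
    also have "\<dots> = sum_list la - sum_list mu"
      using contained_length[OF mu sub] sub by (intro size_diff_rows[symmetric]) auto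
    finally show ?thesis .
  qed
  then have wt: "(\<Sum>i\<in>?I. row la i - row mu i - 1) = wt la mu"
    using broken_ribbon_statistics(3)[OF la mu sub True] by simp
  have "card (?N - ?O) = rib la mu"
    using broken_ribbon_statistics(2)[OF la mu sub True] ON
    by (simp add: card_Diff_subset finite_subset[OF _ finite_nonempty_rows])
  then have "ribbon_weight s t la mu = (- t) ^ card ?O * (s - t) ^ rib la mu * s ^ wt la mu"
    using sub ON NI power_card[of ?O "- t"] power_card[of "?N - ?O" "s - t"]
    by (simp add: ribbon_weight_def factor prod.distrib power_sum[symmetric] wt[simplified] subset_trans[OF Diff_subset])
  then show ?thesis
    using True broken_ribbon_statistics(1)[OF la mu sub True] by simp
qed

section \<open>The skew quantum Murnaghan--Nakayama rule\<close>

lemma mcoeff_sum: "mcoeff (\<Sum>x\<in>A. f x) m = (\<Sum>x\<in>A. mcoeff (f x) m)"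
  by (induction A rule: infinite_finite_induct) (auto simp: zero_mseries_def plus_mseries_def)

lemma mcoeff_scale [simp]: "mcoeff (c *\<^sub>m f) m = c * mcoeff f m"
  by (simp add: mscale_def)

lemma mcoeff_mult: "mcoeff (f * g) m = (\<Sum>(a, b)\<in>splittings m. mcoeff f a * mcoeff g b)"
  by (simp add: times_mseries_def)

lemma mcoeff_skew_schur: "mu \<subseteq>\<^sub>p la \<Longrightarrow> mcoeff (skew_schur la mu) m = tableau_count la mu m"
  by (simp add: skew_schur_def tableau_count_def tableaux_def)

text \<open>
  Every monomial occurs in exactly one monomial symmetric function, the one of the partition formed by
  its exponents, which has as many parts as the monomial has variables.
\<close>

lemma mcoeff_quantum_power_sum:
  fixes q :: "'a::field"
  assumes q: "q \<noteq> 1"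
  shows "mcoeff (quantum_power_sum q r) m =
    (if total_degree m = r then monomial_weight 1 q m / (1 - q) else 0)"
proof -
  define M where "M = image_mset (expo m) (mset_set (vars m))"
  define ta where "ta = rev (sorted_list_of_multiset M)"
  have mset_ta: "mset ta = M" by (simp add: ta_def)
  have "is_partition ta"
    unfolding is_partition_def
  proof
    show "sorted_wrt (\<ge>) ta" by (simp add: ta_def sorted_wrt_rev sorted_sorted_list_of_multiset)
    have "set_mset M = expo m ` vars m" by (simp add: M_def)
    then show "0 \<notin> set ta" by (auto simp flip: set_mset_mset simp: mset_ta in_keys_iff)
  qed
  have unique: "la = ta" if "is_partition la" "mset la = M" for la
  proof -
    have "sorted (rev la)" using that(1) by (simp add: is_partition_def sorted_wrt_rev)
    then have "sort la = rev la" by (intro properties_for_sort) auto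
    moreover have "sorted_list_of_multiset M = sort la" using that(2) by auto
    ultimately show ?thesis by (simp add: ta_def)
  qed
  have size: "sum_list ta = total_degree m" "length ta = card (vars m)"
  proof -
    have "sum_list ta = sum_mset M" by (simp flip: mset_ta add: sum_mset_sum_list)
    then show "sum_list ta = total_degree m"
      by (simp add: M_def total_degree_def sum_unfold_sum_mset)
    have "length ta = size M" by (simp flip: mset_ta)
    then show "length ta = card (vars m)" by (simp add: M_def)
  qed
  let ?c = "\<lambda>ta. (-1) powi (int (length ta) - 1) * (q - 1) powi (int (length ta) - 1)"
  have "mcoeff (quantum_power_sum q r) m =
      (\<Sum>la | is_partition la \<and> sum_list la = r. if la = ta then ?c ta else 0)"
    unfolding quantum_power_sum_def mcoeff_sum
    by (intro sum.cong refl) (auto simp: monomial_sym_def mset_ta M_def[symmetric] dest: unique)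
  also have "\<dots> = (if total_degree m = r then ?c ta else 0)"
    using \<open>is_partition ta\<close> by (simp add: finite_partitions size)
  also have "?c ta = (1 - q) powi (int (card (vars m)) - 1)"
    by (simp add: size flip: power_int_mult_distrib)
  also have "\<dots> = (1 - q) ^ card (vars m) / (1 - q)"
    using q by (simp add: power_int_diff)
  also have "(1 - q) ^ card (vars m) = monomial_weight 1 q m"
    by (simp add: monomial_weight_def exponent_weight_def in_keys_iff)
  finally show ?thesis .
qed

text \<open>
  The sign \<open>(-1) ^ |mu/mm|\<close> turns \<open>(-1)^ht * (q - 1)^rib * q^wt\<close> into
  \<open>(-q)^wt * (1 - q)^rib\<close>, since a broken ribbon has \<open>ht + rib + wt\<close> cells.
\<close>

lemma ribbon_weight_product:
  fixes q :: "'a::field"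
  assumes q: "q \<noteq> 1" and pairs: "(lp, mm) \<in> ribbon_pairs la mu r"
    and la: "is_partition la" and mu: "is_partition mu"
  shows "ribbon_weight 1 q lp la * ribbon_weight q 1 mu mm / (1 - q) =
    (-1) ^ skew_size mu mm * (- q) ^ (ht lp la + wt mu mm) *
      (1 - q) powi (int (rib lp la) + int (rib mu mm) - 1)"
proof -
  have lp: "is_partition lp" "la \<subseteq>\<^sub>p lp" "broken_ribbon lp la"
    and mm: "is_partition mm" "mm \<subseteq>\<^sub>p mu" "broken_ribbon mu mm"
    using pairs by (auto simp: ribbon_pairs_def)
  have "skew_size mu mm = ht mu mm + rib mu mm + wt mu mm"
    using broken_ribbon_statistics[OF mu mm] by (simp add: skew_size_def)
  moreover have "q - 1 = - 1 * (1 - q)" "q = - 1 * (- q)" by simp_all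
  then have "(q - 1) ^ rib mu mm = (- 1) ^ rib mu mm * (1 - q) ^ rib mu mm"
    "q ^ wt mu mm = (- 1) ^ wt mu mm * (- q) ^ wt mu mm"
    by (metis power_mult_distrib)+
  moreover have "(1 - q) powi (int (rib lp la) + int (rib mu mm) - 1) =
      (1 - q) ^ rib lp la * (1 - q) ^ rib mu mm / (1 - q)"
    using q by (simp add: power_int_diff power_int_add)
  ultimately show ?thesis
    using lp mm la mu by (simp add: ribbon_weight_eq power_add mult_ac)
qed

text \<open>
  On both sides the coefficient of \<open>m\<close> vanishes unless the degree of \<open>m\<close> is \<open>|la/mu| + r\<close>.  For \<open>m\<close> of
  that degree, the restrictions to degree \<open>r\<close> on the left and to total size \<open>r\<close> on the right hold
  automatically for all non-zero terms, and the identity is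
  \<open>tableau_count_times_monomial_weight\<close> divided by \<open>1 - q\<close>.
\<close>

theorem skew_quantum_murnaghan_nakayama:
  fixes q :: "'a::field"
  assumes q: "q \<noteq> 1" and la: "is_partition la" and mu: "is_partition mu" and sub: "mu \<subseteq>\<^sub>p la"
  shows "skew_schur la mu * quantum_power_sum q r =
    (\<Sum>(lp, mm)\<in>ribbon_pairs la mu r.
       ((-1) ^ skew_size mu mm * (- q) ^ (ht lp la + wt mu mm)
         * (1 - q) powi (int (rib lp la) + int (rib mu mm) - 1)) *\<^sub>m skew_schur lp mm)"
    (is "_ = (\<Sum>(lp, mm)\<in>_. ?w lp mm *\<^sub>m _)")
proof (rule mseries_eqI)
  fix m :: monomial
  let ?K = "tableau_count :: _ \<Rightarrow> _ \<Rightarrow> _ \<Rightarrow> 'a"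
  have in_pairs: "is_partition lp" "is_partition mm" "la \<subseteq>\<^sub>p lp" "mm \<subseteq>\<^sub>p mu" "mm \<subseteq>\<^sub>p lp"
    "sum_list lp + sum_list mu = sum_list la + sum_list mm + r"
    if "(lp, mm) \<in> ribbon_pairs la mu r" for lp mm
    using that sub contained_size[of la lp] contained_size[of mm mu]
      contained_trans[of mm mu la] contained_trans[of mm la lp]
    by (auto simp: ribbon_pairs_def skew_size_def)
  have left: "mcoeff (skew_schur la mu * quantum_power_sum q r) m =
      (\<Sum>(a, b)\<in>splittings m. ?K la mu a * (if total_degree b = r then monomial_weight 1 q b / (1 - q) else 0))"
    by (simp add: mcoeff_mult mcoeff_skew_schur[OF sub] mcoeff_quantum_power_sum[OF q])
  have right: "mcoeff (\<Sum>(lp, mm)\<in>ribbon_pairs la mu r. ?w lp mm *\<^sub>m skew_schur lp mm) m =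
      (\<Sum>(lp, mm)\<in>ribbon_pairs la mu r. ?w lp mm * ?K lp mm m)"
    unfolding mcoeff_sum
    by (intro sum.cong refl) (auto simp: mcoeff_skew_schur[OF in_pairs(5)])
  show "mcoeff (skew_schur la mu * quantum_power_sum q r) m =
      mcoeff (\<Sum>(lp, mm)\<in>ribbon_pairs la mu r. ?w lp mm *\<^sub>m skew_schur lp mm) m"
  proof (cases "sum_list mu + total_degree m = sum_list la + r")
    case False
    have "?K la mu a * (if total_degree b = r then monomial_weight 1 q b / (1 - q) else 0) = 0"
      if "(a, b) \<in> splittings m" for a b
      using that False tableau_count_degree[of la mu a, where 'a = 'a]
      by (cases "?K la mu a = 0") (auto simp: splittings_def)
    moreover have "?w lp mm * ?K lp mm m = 0" if "(lp, mm) \<in> ribbon_pairs la mu r" for lp mm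
      using in_pairs(6)[OF that] False tableau_count_degree[of lp mm m, where 'a = 'a]
      by (cases "?K lp mm m = 0") auto
    ultimately show ?thesis
      unfolding left right by (auto intro!: sum.neutral trans[OF sum.neutral sum.neutral[symmetric]])
  next
    case True
    define N where "N = sum_list la + sum_list mu + total_degree m"
    let ?P = "partitions_le N"
    obtain n where n: "vars m \<subseteq> {..<n}"
      using finite_nat_set_iff_bounded[of "vars m"] by auto
    have "mcoeff (skew_schur la mu * quantum_power_sum q r) m =
        (\<Sum>(a, b)\<in>splittings m. ?K la mu a * monomial_weight 1 q b) / (1 - q)"
      unfolding left sum_divide_distrib
    proof (intro sum.cong refl, clarify)
      fix a b assume ab: "(a, b) \<in> splittings m"
      show "?K la mu a * (if total_degree b = r then monomial_weight 1 q b / (1 - q) else 0) =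
          ?K la mu a * monomial_weight 1 q b / (1 - q)"
        using ab True tableau_count_degree[of la mu a, where 'a = 'a]
        by (cases "?K la mu a = 0") (auto simp: splittings_def)
    qed
    also have "(\<Sum>(a, b)\<in>splittings m. ?K la mu a * monomial_weight 1 q b) =
        (\<Sum>lp\<in>?P. \<Sum>mm\<in>?P. ribbon_weight 1 q lp la * (ribbon_weight q 1 mu mm * ?K lp mm m))"
      by (rule tableau_count_times_monomial_weight[OF n mu])
        (use la in \<open>auto simp: N_def partitions_le_def\<close>)
    also have "\<dots> = (\<Sum>(lp, mm)\<in>?P \<times> ?P. ribbon_weight 1 q lp la * (ribbon_weight q 1 mu mm * ?K lp mm m))"
      by (rule sum.cartesian_product)
    also have "\<dots> = (\<Sum>(lp, mm)\<in>ribbon_pairs la mu r.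
        ribbon_weight 1 q lp la * (ribbon_weight q 1 mu mm * ?K lp mm m))"
    proof (rule sum.mono_neutral_right)
      show "finite (?P \<times> ?P)" by simp
      show "ribbon_pairs la mu r \<subseteq> ?P \<times> ?P"
      proof (clarify, intro conjI SigmaI)
        fix lp mm assume p: "(lp, mm) \<in> ribbon_pairs la mu r"
        have "sum_list mm \<le> sum_list mu" using contained_size[OF in_pairs(4)[OF p]] .
        then show "lp \<in> ?P" "mm \<in> ?P"
          using in_pairs[OF p] True by (auto simp: partitions_le_def N_def)
      qed
      show "\<forall>x\<in>?P \<times> ?P - ribbon_pairs la mu r. (case x of (lp, mm) \<Rightarrow>
          ribbon_weight 1 q lp la * (ribbon_weight q 1 mu mm * ?K lp mm m)) = 0"
      proof (clarify, rule ccontr)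
        fix lp mm assume P: "lp \<in> ?P" "mm \<in> ?P" "(lp, mm) \<notin> ribbon_pairs la mu r"
          and "ribbon_weight 1 q lp la * (ribbon_weight q 1 mu mm * ?K lp mm m) \<noteq> 0"
        then have nz: "ribbon_weight 1 q lp la \<noteq> 0" "ribbon_weight q 1 mu mm \<noteq> 0" "?K lp mm m \<noteq> 0"
          by auto
        have parts: "is_partition lp" "is_partition mm" using P by (auto dest: partitions_leD)
        have cont: "la \<subseteq>\<^sub>p lp" "mm \<subseteq>\<^sub>p mu"
          using nz(1,2) by (auto simp: ribbon_weight_def split: if_splits)
        have "broken_ribbon lp la" "broken_ribbon mu mm"
          using nz(1,2) cont parts la mu by (auto simp: ribbon_weight_eq split: if_splits)
        moreover have "skew_size lp la + skew_size mu mm = r"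
          using tableau_count_degree[OF nz(3)] True contained_size[OF cont(1)] contained_size[OF cont(2)]
          by (simp add: skew_size_def)
        ultimately show False
          using P(3) parts cont by (simp add: ribbon_pairs_def)
      qed
    qed
    also have "\<dots> / (1 - q) = (\<Sum>(lp, mm)\<in>ribbon_pairs la mu r. ?w lp mm * ?K lp mm m)"
      unfolding sum_divide_distrib
    proof (intro sum.cong refl, clarify)
      fix lp mm assume p: "(lp, mm) \<in> ribbon_pairs la mu r"
      show "ribbon_weight 1 q lp la * (ribbon_weight q 1 mu mm * ?K lp mm m) / (1 - q) =
          ?w lp mm * ?K lp mm m"
        unfolding ribbon_weight_product[OF q p la mu, symmetric] by simp
    qed
    finally show ?thesis unfolding right .
  qed
qed

lemma q_indet_neq_1: "q_indet \<noteq> 1"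
  by (simp add: q_indet_def One_fract_def eq_fract one_pCons)

theorem theorem5:
  fixes la mu :: "nat list" and r :: nat
  assumes "is_partition la" and "is_partition mu" and "mu \<subseteq>\<^sub>p la"
  shows "skew_schur la mu * quantum_power_sum q_indet r =
    (\<Sum>(lp, mm)\<in>ribbon_pairs la mu r.
       ((-1) ^ skew_size mu mm
         * (- q_indet) ^ (ht lp la + wt mu mm)
         * (1 - q_indet) powi (int (rib lp la) + int (rib mu mm) - 1))
       *\<^sub>m skew_schur lp mm)"
  using q_indet_neq_1 assms by (rule skew_quantum_murnaghan_nakayama)

end
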